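(* Consider the distributionally robust two-stage stochastic mixed-integer convex program $$\text{(DR-TSS-MICP)}\quad \min_x\Big\{c^\top x+\max_{P\in\mathcal P}\mathbb E_{\xi\sim P}[\mathcal Q(x,\xi)]:\ Ax\le b,\ x\in\mathcal C,\ x\in\{0,1\}^{l_1}\Big\}$$ described in the context, and suppose the assumptions listed there hold. If the master problem and scenario sub-problems are solved to optimality or detected infeasible in every iteration of the decomposition linearize-branch-and-union algorithm (Algorithm 5, described in the context), the algorithm returns an optimal solution of (DR-TSS-MICP) or detects its infeasibility in a finite number of iterations.
   Context: Setting: $\mathcal C$ is a closed convex set, $\mathcal X=\{x:Ax\le b\}$ is a polytope; $\xi$ has finite support $\{\xi^\omega:\omega\in\Omega\}$; $\mathcal P\subset\mathbb R^{|\Omega|}$ is a compact set of probability distributions on $\Omega$ over which an oracle optimizes linear functions. The recourse function $\mathcal Q(x,\xi^\omega)$ is the optimal value of $$\mathrm{Sub}(x,\omega):\ \min\{h^{\omega\top}y:\ T^\omega x+W^\omega y=q^\omega,\ g_i^\omega(x,y)\le0\ \forall i\in\mathcal I,\ y\in\mathcal Y^\omega\cap(\mathbb Z^{l_2}\times\mathbb R^{l_3})\},$$ with $g_i^\omega$ convex (not necessarily smooth) in $(x,y)$ and $\mathcal Y^\omega$ a polytope. Assumptions. (i) $\partial g_i^\omega(x_0,y_0)=\partial_xg_i^\omega(x_0,y_0)\times\partial_yg_i^\omega(x_0,y_0)$ at every point (partial subdifferentials in $x$ and in $y$). (ii) For any $\hat x\in\mathcal X\cap\{0,1\}^{l_1}$,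 any $\hat z\in\mathbb Z^{l_2}$ (and each $\omega\in\Omega$), the set $\{y\in\mathbb R^{l_2+l_3}: T^\omega\hat x+W^\omega y=q^\omega,\ g^\omega_i(\hat x,y)\le0\ \forall i\in\mathcal I,\ y\in\mathcal Y^\omega,\ y_j=\hat z_j\ \forall j\in[l_2]\}$ either is empty or has a non-empty relative interior. (iii) Every constraint function of every optimization problem occurring belongs to a collection $\mathcal F$ of convex functions, each with domain $\mathbb R^k$ for some $1\le k\le n$, that is closed under fixing some of the variables to constants; an oracle solves to optimality, or detects infeasibility of, any convex optimization problem generated by a finite subset of $\mathcal F$; an oracle generates a subgradient of any $f\in\mathcal F$ at any point and the normal cone, at any point, of any closed convex set generated by a finite subset of $\mathcal F$. Modified-Algorithm 2 for $\mathrm{Sub}(\hat x,\omega)$. At its iteration $n$ it (1) solves by branch-and-bound a mixed-integer linear master problem in $y$ ($T^\omega\hat x+W^\omega y=q^\omega$, $y\in\mathcal Y^\omega\cap(\mathbb Z^{l_2}\times\mathbb R^{l_3})$, and previously added cuts in $(x,y)$ evaluated at $x=\hat x$); it claims infeasibility if the master is infeasible, and otherwise obtains a master solution $y^{(n)}$, which it returns if $(\hat x,y^{(n)})\in\mathcal S^\omega=\{(x,y): g_i^\omega(x,y)\le0\ \forall i,\ y\in\mathcal Y^\omega\}$; (2) adds the cut given by the hyperplane through the Euclidean projection of $(\hat x,y^{(n)})$ onto $\mathcal S^\omega$, normal to the projection direction; (3) solves the convex program obtained by fixing the integer components of $y$ to those of $y^{(n)}$; if it is feasible, it returns its optimal solution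 if its value equals the master value, and otherwise, if the optimal solution $\hat y$ satisfies $(\hat x,\hat y)\in\mathrm{bd}(\mathcal S^\omega)$, adds a cut $d_x^\top(x-\hat x)+d_y^\top(y-\hat y)\le0$ with $(d_x,d_y)$ in the normal cone of $\{(x,y):g^\omega_i(x,y)\le0\ \forall i\}$ at $(\hat x,\hat y)$ and with $d_y$ in the normal cone of $\{y: g^\omega_i(\hat x,y)\le0\ \forall i\}$ at $\hat y$ chosen so that replacing the constraints $g^\omega_i(\hat x,y)\le0$ by $d_y^\top(y-\hat y)\le0$ preserves the optimal value of the integer-fixed program. (No cuts are added inside the branch-and-bound tree.) Leaf nodes. When Modified-Algorithm 2 terminates with an optimal solution, $\mathcal L^\omega(\hat x)$ denotes the set of leaf nodes of the branch-and-bound tree of the last master problem (the leaves together containing all feasible solutions of the master problem, regardless of objective value). The linear program at leaf $\nu$ is $\min\{h^{\omega\top}y: W^\omega y=-T^\omega\hat x+q^\omega,\ Q^\omega_\nu y\le -R^\omega_\nu\hat x-s^\omega_\nu,\ y\in\mathbb R^{l_2+l_3}\}$, where $R_\nu^\omega x+Q_\nu^\omega y+s_\nu^\omega\le0$ are the linear inequality constraints of the node in $(x,y)$-form (master inequality constraints, including the cuts, and the simple bounds on $y$ defining $\nu$); $\theta^\omega_\nu$ and $\mu^\omega_\nu\ge0$ are the optimal values of its dual vectors for the equality and inequality constraints, obtained after solving it, so that its optimal value is $\theta_\nu^{\omega\top}(-T^\omega\hat x+q^\omega)+\mu_\nu^{\omega\top}(R_\nu^\omega\hat x+s_\nu^\omega)$.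 Cut-generating linear program at $\hat x$ for scenario $\omega$: $$\max\ \lambda^\top\hat x+\sigma\ \text{ s.t. }\ \lambda-R_\nu^{\omega\top}\mu_\nu^\omega+T^{\omega\top}\theta_\nu^\omega-A^\top\beta_\nu-\gamma_\nu\le0,\quad \sigma-\mu_\nu^{\omega\top}s_\nu^\omega-\theta_\nu^{\omega\top}q^\omega+\beta_\nu^\top b+\gamma_\nu^\top\mathbf 1\le0,\quad \beta_\nu,\gamma_\nu\ge0\quad\forall\nu\in\mathcal L^\omega(\hat x),$$ with $\lambda\in\mathbb R^{l_1}$, $\sigma\in\mathbb R$ and $\mathbf 1$ the all-ones vector. Algorithm 5. Set $L=-\infty$, $U=+\infty$, $m=1$. While $U-L>0$: - Solve to optimality the first-stage master problem of minimizing $c^\top x+\eta$ over $x\in\mathcal C\cap\{0,1\}^{l_1}$ and $\eta$ subject to $Ax\le b$ and all Benders' and feasibility cuts added so far. If it is infeasible, stop and claim that (DR-TSS-MICP) is infeasible. Let $(\eta^m,x^m)$ be the optimal solution and set $L\leftarrow c^\top x^m+\eta^m$. - Set the current best solution $x^*\leftarrow x^m$. - For $\omega\in\Omega$: use Modified-Algorithm 2 to solve $\mathrm{Sub}(x^m,\omega)$. If it is detected to be infeasible, break and add the feasibility cut $\sum_{j:x^m_j=0}x_j+\sum_{j:x^m_j=1}(1-x_j)\ge1$ to the master problem. When it terminates with an optimal solution, solve the cut-generating linear program with $\hat x=x^m$ to determine the coefficients $\lambda^{m\omega*}$ and $\sigma^{m\omega*}$ (the $(\lambda,\sigma)$-part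 of an optimal solution). - Obtain the worst-case distribution $(p^{m\omega})_{\omega\in\Omega}$ maximizing $\sum_\omega p^\omega\mathcal Q(x^m,\xi^\omega)$ over $p\in\mathcal P$. - Add the aggregated Benders' cut $\eta\ge\sum_\omega p^{m\omega}\lambda^{m\omega*\top}x+\sum_\omega p^{m\omega}\sigma^{m\omega*}$ to the master problem. - Update $U\leftarrow\min\{U,\ c^\top x^m+\sum_\omega p^{m\omega}\mathcal Q(x^m,\xi^\omega)\}$ and $m\leftarrow m+1$. When the loop ends return $x^*$.
   Formalization: x* is replaced by x^m only when x^m improves U (else ties can return a non-optimal point); leaves infeasible at x^m, having no optimal duals, use dual feasible vectors with value at least the master optimum; η may be -∞, as the first master is otherwise unbounded. *)

theory Defs
  imports "HOL-Analysis.Analysis"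
begin

section \<open>Convex analysis\<close>

definition subdifferential :: "('a::euclidean_space \<Rightarrow> real) \<Rightarrow> 'a \<Rightarrow> 'a set" where
  "subdifferential f a = {d. \<forall>v. f v \<ge> f a + d \<bullet> (v - a)}"

definition normal_cone :: "'a::euclidean_space set \<Rightarrow> 'a \<Rightarrow> 'a set" where
  "normal_cone S a = {d. \<forall>v\<in>S. d \<bullet> (v - a) \<le> 0}"


section \<open>The collection of constraint functions and the oracles\<close>

text \<open>
  A member \<open>(k, f)\<close> of a function collection is a function \<open>f\<close> with domain \<open>\<real>\<^sup>k\<close>; a point of \<open>\<real>\<^sup>k\<close>
  is a list of length \<open>k\<close>.
\<close>

type_synonym function_collection = "(nat \<times> (real list \<Rightarrow> real)) set"

definition convex_Rk :: "nat \<Rightarrow> (real list \<Rightarrow> real) \<Rightarrow> bool" where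
  "convex_Rk k f \<longleftrightarrow>
     (\<forall>u v t. length u = k \<longrightarrow> length v = k \<longrightarrow> 0 \<le> t \<longrightarrow> t \<le> 1 \<longrightarrow>
        f (map2 (\<lambda>a b. (1 - t) * a + t * b) u v) \<le> (1 - t) * f u + t * f v)"

text \<open>
  Closure under fixing one variable (the one at position \<open>i\<close>) gives, by iteration, closure under
  fixing any number of variables, as long as at least one variable remains.
\<close>

definition admissible_collection :: "nat \<Rightarrow> function_collection \<Rightarrow> bool" where
  "admissible_collection n F \<longleftrightarrow>
     (\<forall>(k, f)\<in>F. 1 \<le> k \<and> k \<le> n \<and> convex_Rk k f) \<and>
     (\<forall>(k, f)\<in>F. \<forall>i<k. \<forall>a. 2 \<le> k \<longrightarrow> (k - 1, \<lambda>v. f (take i v @ a # drop i v)) \<in> F)"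

text \<open>
  A function on a Euclidean space belongs to the collection if it is a member of it applied to some
  \<open>k\<close> distinct coordinates of its argument.
\<close>

definition belongs_to :: "function_collection \<Rightarrow> ('a::euclidean_space \<Rightarrow> real) \<Rightarrow> bool" where
  "belongs_to F G \<longleftrightarrow>
     (\<exists>k f bs. (k, f) \<in> F \<and> length bs = k \<and> distinct bs \<and> set bs \<subseteq> Basis \<and>
        G = (\<lambda>v. f (map (\<lambda>b. v \<bullet> b) bs)))"

text \<open>
  Nothing is required of the answer if the program is feasible but its infimum is not attained:
  such a program can neither be solved to optimality nor be infeasible.
\<close>

definition convex_program_oracle ::
  "function_collection \<Rightarrow> (('a::euclidean_space \<Rightarrow> real) set \<Rightarrow> ('a \<Rightarrow> real) \<Rightarrow> 'a option) \<Rightarrow> bool" where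
  "convex_program_oracle F solve \<longleftrightarrow>
     (\<forall>G f. finite G \<longrightarrow> (\<forall>g\<in>G. belongs_to F g) \<longrightarrow> convex_on UNIV f \<longrightarrow>
        (let feasible = (\<lambda>v. \<forall>g\<in>G. g v \<le> 0) in
          ((\<nexists>v. feasible v) \<longrightarrow> solve G f = None) \<and>
          ((\<exists>v. is_arg_min f feasible v) \<longrightarrow>
             (\<exists>v. solve G f = Some v \<and> is_arg_min f feasible v))))"

definition subgradient_oracle ::
  "function_collection \<Rightarrow> (('a::euclidean_space \<Rightarrow> real) \<Rightarrow> 'a \<Rightarrow> 'a) \<Rightarrow> bool" where
  "subgradient_oracle F subgrad \<longleftrightarrow>
     (\<forall>f. belongs_to F f \<longrightarrow> (\<forall>v. subgrad f v \<in> subdifferential f v))"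

definition normal_cone_oracle ::
  "function_collection \<Rightarrow> (('a::euclidean_space \<Rightarrow> real) set \<Rightarrow> 'a \<Rightarrow> 'a set) \<Rightarrow> bool" where
  "normal_cone_oracle F ncone \<longleftrightarrow>
     (\<forall>G. finite G \<longrightarrow> (\<forall>g\<in>G. belongs_to F g) \<longrightarrow>
        (\<forall>a. (\<forall>g\<in>G. g a \<le> 0) \<longrightarrow> ncone G a = normal_cone {v. \<forall>g\<in>G. g v \<le> 0} a))"

definition linear_oracle :: "'a::euclidean_space set \<Rightarrow> ('a \<Rightarrow> 'a) \<Rightarrow> bool" where
  "linear_oracle P worst \<longleftrightarrow> (\<forall>r. worst r \<in> P \<and> (\<forall>p\<in>P. r \<bullet> p \<le> r \<bullet> worst r))"


section \<open>The two-stage problem\<close>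

text \<open>
  \<open>Jint\<close> is the set of the integer coordinates of \<open>y\<close> (so \<open>l\<^sub>2 = card Jint\<close>), and the polytope
  \<open>\<Y>\<^sup>\<omega>\<close> is given by finitely many inequalities \<open>a \<bullet> y \<le> r\<close>, \<open>(a, r) \<in> Yineq \<omega>\<close>.
\<close>

record ('x, 'y, 'w, 'e, 'm, 'i) dr_tss_micp =
  cvec :: "real^('x::finite)"
  Amat :: "real^('x::finite)^('m::finite)"
  bvec :: "real^('m::finite)"
  Cset :: "(real^('x::finite)) set"
  Pset :: "(real^('w::finite)) set"
  hvec :: "'w \<Rightarrow> real^('y::finite)"
  Tmat :: "'w \<Rightarrow> real^('x::finite)^('e::finite)"
  Wmat :: "'w \<Rightarrow> real^('y::finite)^('e::finite)"
  qvec :: "'w \<Rightarrow> real^('e::finite)"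
  Iset :: "'i set"
  gfun :: "'w \<Rightarrow> 'i \<Rightarrow> (real^('x::finite)) \<times> (real^('y::finite)) \<Rightarrow> real"
  Yineq :: "'w \<Rightarrow> ((real^('y::finite)) \<times> real) set"
  Jint :: "('y::finite) set"

type_synonym ('x, 'y, 'w, 'e, 'm, 'i) problem =
  "('x, 'y, 'w, 'e, 'm, 'i) dr_tss_micp"

definition Xset :: "('x::finite,'y::finite,'w::finite,'e::finite,'m::finite,'i) problem \<Rightarrow> (real^'x) set" where
  "Xset D = {x. \<forall>r. (Amat D *v x) $ r \<le> bvec D $ r}"

definition binary :: "real^'x::finite \<Rightarrow> bool" where
  "binary x \<longleftrightarrow> (\<forall>j. x $ j \<in> {0, 1})"

definition first_stage :: "('x::finite,'y::finite,'w::finite,'e::finite,'m::finite,'i) problem \<Rightarrow> (real^'x) set" where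
  "first_stage D = {x \<in> Xset D \<inter> Cset D. binary x}"

definition Yset :: "('x::finite,'y::finite,'w::finite,'e::finite,'m::finite,'i) problem \<Rightarrow> 'w \<Rightarrow> (real^'y) set" where
  "Yset D \<omega> = {y. \<forall>(a, r)\<in>Yineq D \<omega>. a \<bullet> y \<le> r}"

definition integral_part :: "('x::finite,'y::finite,'w::finite,'e::finite,'m::finite,'i) problem \<Rightarrow> real^'y \<Rightarrow> bool" where
  "integral_part D y \<longleftrightarrow> (\<forall>j\<in>Jint D. y $ j \<in> \<int>)"

definition Gset :: "('x::finite,'y::finite,'w::finite,'e::finite,'m::finite,'i) problem \<Rightarrow> 'w \<Rightarrow> ((real^'x) \<times> (real^'y)) set" where
  "Gset D \<omega> = {v. \<forall>i\<in>Iset D. gfun D \<omega> i v \<le> 0}"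

definition Sset :: "('x::finite,'y::finite,'w::finite,'e::finite,'m::finite,'i) problem \<Rightarrow> 'w \<Rightarrow> ((real^'x) \<times> (real^'y)) set" where
  "Sset D \<omega> = {(x, y). (x, y) \<in> Gset D \<omega> \<and> y \<in> Yset D \<omega>}"

definition sub_relaxed_feasible ::
  "('x::finite,'y::finite,'w::finite,'e::finite,'m::finite,'i) problem \<Rightarrow> 'w \<Rightarrow> real^'x \<Rightarrow> (real^'y) set" where
  "sub_relaxed_feasible D \<omega> x =
     {y. Tmat D \<omega> *v x + Wmat D \<omega> *v y = qvec D \<omega> \<and> (\<forall>i\<in>Iset D. gfun D \<omega> i (x, y) \<le> 0) \<and> y \<in> Yset D \<omega>}"

definition sub_feasible ::
  "('x::finite,'y::finite,'w::finite,'e::finite,'m::finite,'i) problem \<Rightarrow> 'w \<Rightarrow> real^'x \<Rightarrow> (real^'y) set" where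
  "sub_feasible D \<omega> x = {y \<in> sub_relaxed_feasible D \<omega> x. integral_part D y}"

definition recourse :: "('x::finite,'y::finite,'w::finite,'e::finite,'m::finite,'i) problem \<Rightarrow> real^'x \<Rightarrow> 'w \<Rightarrow> ereal" where
  "recourse D x \<omega> = (INF y\<in>sub_feasible D \<omega> x. ereal (hvec D \<omega> \<bullet> y))"

definition expected_recourse ::
  "('x::finite,'y::finite,'w::finite,'e::finite,'m::finite,'i) problem \<Rightarrow> real^'x \<Rightarrow> real^'w \<Rightarrow> ereal" where
  "expected_recourse D x p = (\<Sum>\<omega>\<in>UNIV. ereal (p $ \<omega>) * recourse D x \<omega>)"

text \<open>
  A first-stage decision is feasible only if every scenario sub-problem is feasible.  The case
  distinction matters only for scenarios that have probability zero under every distribution in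
  the ambiguity set, as \<open>0 * \<infinity> = 0\<close> in extended-real arithmetic.
\<close>

definition worst_case_recourse ::
  "('x::finite,'y::finite,'w::finite,'e::finite,'m::finite,'i) problem \<Rightarrow> real^'x \<Rightarrow> ereal" where
  "worst_case_recourse D x =
     (if \<exists>\<omega>. recourse D x \<omega> = \<infinity> then \<infinity> else (SUP p\<in>Pset D. expected_recourse D x p))"

definition dr_objective :: "('x::finite,'y::finite,'w::finite,'e::finite,'m::finite,'i) problem \<Rightarrow> real^'x \<Rightarrow> ereal" where
  "dr_objective D x = ereal (cvec D \<bullet> x) + worst_case_recourse D x"

definition dr_feasible :: "('x::finite,'y::finite,'w::finite,'e::finite,'m::finite,'i) problem \<Rightarrow> real^'x \<Rightarrow> bool" where
  "dr_feasible D x \<longleftrightarrow> x \<in> first_stage D \<and> dr_objective D x < \<infinity>"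

definition dr_optimal :: "('x::finite,'y::finite,'w::finite,'e::finite,'m::finite,'i) problem \<Rightarrow> real^'x \<Rightarrow> bool" where
  "dr_optimal D x \<longleftrightarrow> is_arg_min (dr_objective D) (dr_feasible D) x"

definition dr_infeasible :: "('x::finite,'y::finite,'w::finite,'e::finite,'m::finite,'i) problem \<Rightarrow> bool" where
  "dr_infeasible D \<longleftrightarrow> (\<nexists>x. dr_feasible D x)"


section \<open>Assumptions on the constraint functions\<close>

definition subdifferentials_split ::
  "('x::finite,'y::finite,'w::finite,'e::finite,'m::finite,'i) problem \<Rightarrow> bool" where
  "subdifferentials_split D \<longleftrightarrow>
     (\<forall>\<omega>. \<forall>i\<in>Iset D. \<forall>x y. subdifferential (gfun D \<omega> i) (x, y) =
        subdifferential (\<lambda>x'. gfun D \<omega> i (x', y)) x \<times> subdifferential (\<lambda>y'. gfun D \<omega> i (x, y')) y)"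

definition fixed_sets_regular ::
  "('x::finite,'y::finite,'w::finite,'e::finite,'m::finite,'i) problem \<Rightarrow> bool" where
  "fixed_sets_regular D \<longleftrightarrow>
     (\<forall>x\<in>Xset D. binary x \<longrightarrow> (\<forall>(z :: 'y \<Rightarrow> int) \<omega>.
        let S = {y \<in> sub_relaxed_feasible D \<omega> x. \<forall>j\<in>Jint D. y $ j = of_int (z j)}
        in S = {} \<or> rel_interior S \<noteq> {}))"


section \<open>Linear constraints, branch-and-bound trees and leaf linear programs\<close>

text \<open>The triple \<open>(r, q, s)\<close> is the linear constraint \<open>r \<bullet> x + q \<bullet> y + s \<le> 0\<close>.\<close>

type_synonym ('x, 'y) lincon = "(real^'x) \<times> (real^'y) \<times> real"

definition lin_fun :: "('x::finite,'y::finite) lincon \<Rightarrow> (real^'x) \<times> (real^'y) \<Rightarrow> real" where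
  "lin_fun = (\<lambda>(r, q, s) (x, y). r \<bullet> x + q \<bullet> y + s)"

definition lp_feasible ::
  "('x::finite,'y::finite,'w::finite,'e::finite,'m::finite,'i) problem \<Rightarrow> 'w \<Rightarrow> real^'x \<Rightarrow> ('x,'y) lincon set \<Rightarrow> (real^'y) set" where
  "lp_feasible D \<omega> x K =
     {y. Tmat D \<omega> *v x + Wmat D \<omega> *v y = qvec D \<omega> \<and> (\<forall>k\<in>K. lin_fun k (x, y) \<le> 0)}"

definition master_cons ::
  "('x::finite,'y::finite,'w::finite,'e::finite,'m::finite,'i) problem \<Rightarrow> 'w \<Rightarrow> ('x,'y) lincon set \<Rightarrow> ('x,'y) lincon set" where
  "master_cons D \<omega> cuts = (\<lambda>(a, r). (0, a, - r)) ` Yineq D \<omega> \<union> cuts"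

definition milp_feasible ::
  "('x::finite,'y::finite,'w::finite,'e::finite,'m::finite,'i) problem \<Rightarrow> 'w \<Rightarrow> real^'x \<Rightarrow> ('x,'y) lincon set \<Rightarrow> (real^'y) set" where
  "milp_feasible D \<omega> x cuts = {y \<in> lp_feasible D \<omega> x (master_cons D \<omega> cuts). integral_part D y}"

text \<open>\<open>Branch j k l r\<close> branches on \<open>y\<^sub>j \<le> k\<close> (subtree \<open>l\<close>) versus \<open>y\<^sub>j \<ge> k + 1\<close> (subtree \<open>r\<close>).\<close>

datatype 'y bb_tree = Leaf | Branch 'y int "'y bb_tree" "'y bb_tree"

fun branch_vars :: "'y bb_tree \<Rightarrow> 'y set" where
  "branch_vars Leaf = {}"
| "branch_vars (Branch j k l r) = insert j (branch_vars l \<union> branch_vars r)"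

text \<open>
  A leaf is identified with the set of all linear inequality constraints of its node: those of the
  root, \<open>K\<close>, and the simple bounds on the path from the root.
\<close>

fun bb_leaves :: "'y::finite bb_tree \<Rightarrow> ('x::finite,'y) lincon set \<Rightarrow> ('x,'y) lincon set set" where
  "bb_leaves Leaf K = {K}"
| "bb_leaves (Branch j k l r) K =
     bb_leaves l (insert (0, axis j 1, - of_int k) K) \<union>
     bb_leaves r (insert (0, - axis j 1, of_int k + 1) K)"

text \<open>
  Reasons for not branching at a leaf, \<open>v\<close> being the value of the final incumbent: infeasibility,
  an integral solution of its linear program, or a bound not better than \<open>v\<close>.
\<close>

definition fathomed ::
  "('x::finite,'y::finite,'w::finite,'e::finite,'m::finite,'i) problem \<Rightarrow> 'w \<Rightarrow> real^'x \<Rightarrow> real \<Rightarrow> ('x,'y) lincon set \<Rightarrow> bool" where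
  "fathomed D \<omega> x v K \<longleftrightarrow>
     lp_feasible D \<omega> x K = {} \<or>
     (\<exists>y. is_arg_min (\<lambda>y. hvec D \<omega> \<bullet> y) (\<lambda>y. y \<in> lp_feasible D \<omega> x K) y \<and> integral_part D y) \<or>
     (\<forall>y\<in>lp_feasible D \<omega> x K. v \<le> hvec D \<omega> \<bullet> y)"

definition bb_solves ::
  "('x::finite,'y::finite,'w::finite,'e::finite,'m::finite,'i) problem \<Rightarrow> 'w \<Rightarrow> real^'x \<Rightarrow> ('x,'y) lincon set \<Rightarrow>
   real^'y \<Rightarrow> 'y bb_tree \<Rightarrow> bool" where
  "bb_solves D \<omega> x cuts y t \<longleftrightarrow>
     is_arg_min (\<lambda>y. hvec D \<omega> \<bullet> y) (\<lambda>y. y \<in> milp_feasible D \<omega> x cuts) y \<and>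
     branch_vars t \<subseteq> Jint D \<and>
     (\<forall>K\<in>bb_leaves t (master_cons D \<omega> cuts). fathomed D \<omega> x (hvec D \<omega> \<bullet> y) K)"

definition leaf_dual_feasible ::
  "('x::finite,'y::finite,'w::finite,'e::finite,'m::finite,'i) problem \<Rightarrow> 'w \<Rightarrow> ('x,'y) lincon set \<Rightarrow>
   (real^'e) \<times> (('x,'y) lincon \<Rightarrow> real) \<Rightarrow> bool" where
  "leaf_dual_feasible D \<omega> K = (\<lambda>(\<theta>, \<mu>).
     (\<forall>k\<in>K. 0 \<le> \<mu> k) \<and>
     transpose (Wmat D \<omega>) *v \<theta> - (\<Sum>(r, q, s)\<in>K. \<mu> (r, q, s) *\<^sub>R q) = hvec D \<omega>)"

definition leaf_dual_value ::
  "('x::finite,'y::finite,'w::finite,'e::finite,'m::finite,'i) problem \<Rightarrow> 'w \<Rightarrow> real^'x \<Rightarrow> ('x,'y) lincon set \<Rightarrow>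
   (real^'e) \<times> (('x,'y) lincon \<Rightarrow> real) \<Rightarrow> real" where
  "leaf_dual_value D \<omega> x K = (\<lambda>(\<theta>, \<mu>).
     \<theta> \<bullet> (qvec D \<omega> - Tmat D \<omega> *v x) + (\<Sum>(r, q, s)\<in>K. \<mu> (r, q, s) * (r \<bullet> x + s)))"

text \<open>
  The dual vectors obtained at a leaf.  If the leaf is infeasible at \<open>x\<close>, its dual is unbounded and
  has no optimal solution; a leaf fathomed by infeasibility then supplies dual feasible vectors
  whose objective value reaches the optimal value \<open>v\<close> of the master problem (the cutoff value of
  the branch-and-bound).  Such leaves cannot be dropped: they may be feasible at other points.
\<close>

definition leaf_duals ::
  "('x::finite,'y::finite,'w::finite,'e::finite,'m::finite,'i) problem \<Rightarrow> 'w \<Rightarrow> real^'x \<Rightarrow> real \<Rightarrow> ('x,'y) lincon set \<Rightarrow>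
   (real^'e) \<times> (('x,'y) lincon \<Rightarrow> real) \<Rightarrow> bool" where
  "leaf_duals D \<omega> x v K d \<longleftrightarrow>
     (if lp_feasible D \<omega> x K \<noteq> {}
      then is_arg_max (leaf_dual_value D \<omega> x K) (leaf_dual_feasible D \<omega> K) d
      else leaf_dual_feasible D \<omega> K d \<and> v \<le> leaf_dual_value D \<omega> x K d)"


section \<open>The cut-generating linear program\<close>

type_synonym ('x, 'y, 'm) cut_lp_point =
  "(real^'x) \<times> real \<times> (('x,'y) lincon set \<Rightarrow> real^'m) \<times> (('x,'y) lincon set \<Rightarrow> real^'x)"

definition cut_lp_feasible ::
  "('x::finite,'y::finite,'w::finite,'e::finite,'m::finite,'i) problem \<Rightarrow> 'w \<Rightarrow> ('x,'y) lincon set set \<Rightarrow>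
   (('x,'y) lincon set \<Rightarrow> (real^'e) \<times> (('x,'y) lincon \<Rightarrow> real)) \<Rightarrow> ('x,'y,'m) cut_lp_point \<Rightarrow> bool" where
  "cut_lp_feasible D \<omega> \<L> duals = (\<lambda>(l, \<sigma>, \<beta>, \<gamma>). \<forall>\<nu>\<in>\<L>. let (\<theta>, \<mu>) = duals \<nu> in
     (\<forall>j. (l - (\<Sum>(r, q, s)\<in>\<nu>. \<mu> (r, q, s) *\<^sub>R r) + transpose (Tmat D \<omega>) *v \<theta>
            - transpose (Amat D) *v \<beta> \<nu> - \<gamma> \<nu>) $ j \<le> 0) \<and>
     \<sigma> - (\<Sum>(r, q, s)\<in>\<nu>. \<mu> (r, q, s) * s) - \<theta> \<bullet> qvec D \<omega> + \<beta> \<nu> \<bullet> bvec D + \<gamma> \<nu> \<bullet> 1 \<le> 0 \<and>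
     (\<forall>i. 0 \<le> \<beta> \<nu> $ i) \<and> (\<forall>j. 0 \<le> \<gamma> \<nu> $ j))"

definition cut_lp_optimal ::
  "('x::finite,'y::finite,'w::finite,'e::finite,'m::finite,'i) problem \<Rightarrow> 'w \<Rightarrow> real^'x \<Rightarrow> ('x,'y) lincon set set \<Rightarrow>
   (('x,'y) lincon set \<Rightarrow> (real^'e) \<times> (('x,'y) lincon \<Rightarrow> real)) \<Rightarrow> ('x,'y,'m) cut_lp_point \<Rightarrow> bool" where
  "cut_lp_optimal D \<omega> x \<L> duals =
     is_arg_max (\<lambda>(l, \<sigma>, \<beta>, \<gamma>). l \<bullet> x + \<sigma>) (cut_lp_feasible D \<omega> \<L> duals)"


section \<open>The algorithm for a scenario sub-problem\<close>

definition fixed_feasible ::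
  "('x::finite,'y::finite,'w::finite,'e::finite,'m::finite,'i) problem \<Rightarrow> 'w \<Rightarrow> real^'x \<Rightarrow> real^'y \<Rightarrow> (real^'y) set" where
  "fixed_feasible D \<omega> x z = {y \<in> sub_relaxed_feasible D \<omega> x. \<forall>j\<in>Jint D. y $ j = z $ j}"

definition fixed_optimal ::
  "('x::finite,'y::finite,'w::finite,'e::finite,'m::finite,'i) problem \<Rightarrow> 'w \<Rightarrow> real^'x \<Rightarrow> real^'y \<Rightarrow> real^'y \<Rightarrow> bool" where
  "fixed_optimal D \<omega> x z = is_arg_min (\<lambda>y. hvec D \<omega> \<bullet> y) (\<lambda>y. y \<in> fixed_feasible D \<omega> x z)"

definition projection_cut ::
  "('x::finite,'y::finite,'w::finite,'e::finite,'m::finite,'i) problem \<Rightarrow> 'w \<Rightarrow> real^'x \<Rightarrow> real^'y \<Rightarrow> ('x,'y) lincon \<Rightarrow> bool" where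
  "projection_cut D \<omega> x y k \<longleftrightarrow>
     (\<exists>\<pi>. is_arg_min (dist (x, y)) (\<lambda>v. v \<in> Sset D \<omega>) \<pi> \<and>
        k = (x - fst \<pi>, y - snd \<pi>, - (((x, y) - \<pi>) \<bullet> \<pi>)))"

text \<open>The cut \<open>d\<^sub>x \<bullet> (x' - x) + d\<^sub>y \<bullet> (y' - y) \<le> 0\<close> at the solution \<open>y\<close> of the program with integer part of \<open>z\<close>.\<close>

definition normal_cut ::
  "('x::finite,'y::finite,'w::finite,'e::finite,'m::finite,'i) problem \<Rightarrow> 'w \<Rightarrow> real^'x \<Rightarrow> real^'y \<Rightarrow> real^'y \<Rightarrow> ('x,'y) lincon \<Rightarrow> bool" where
  "normal_cut D \<omega> x z y k \<longleftrightarrow>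
     (\<exists>dx dy. k = (dx, dy, - (dx \<bullet> x + dy \<bullet> y)) \<and>
        (dx, dy) \<in> normal_cone (Gset D \<omega>) (x, y) \<and>
        dy \<in> normal_cone {y'. (x, y') \<in> Gset D \<omega>} y \<and>
        (INF y'\<in>{y'. Tmat D \<omega> *v x + Wmat D \<omega> *v y' = qvec D \<omega> \<and> dy \<bullet> (y' - y) \<le> 0 \<and>
             y' \<in> Yset D \<omega> \<and> (\<forall>j\<in>Jint D. y' $ j = z $ j)}. ereal (hvec D \<omega> \<bullet> y'))
          = (INF y'\<in>fixed_feasible D \<omega> x z. ereal (hvec D \<omega> \<bullet> y')))"

text \<open>The sets of cuts with which an iteration of the algorithm for \<open>Sub(x, \<omega>)\<close> may start.\<close>

inductive sub_alg_cuts ::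
  "('x::finite,'y::finite,'w::finite,'e::finite,'m::finite,'i) problem \<Rightarrow> 'w \<Rightarrow> real^'x \<Rightarrow> ('x,'y) lincon set \<Rightarrow> bool"
  for D \<omega> x where
  start: "sub_alg_cuts D \<omega> x {}"
| fixed_infeasible:
    "\<lbrakk> sub_alg_cuts D \<omega> x cuts; bb_solves D \<omega> x cuts y t; (x, y) \<notin> Sset D \<omega>;
       projection_cut D \<omega> x y k; fixed_feasible D \<omega> x y = {} \<rbrakk>
     \<Longrightarrow> sub_alg_cuts D \<omega> x (insert k cuts)"
| fixed_interior:
    "\<lbrakk> sub_alg_cuts D \<omega> x cuts; bb_solves D \<omega> x cuts y t; (x, y) \<notin> Sset D \<omega>;
       projection_cut D \<omega> x y k; fixed_optimal D \<omega> x y yh; hvec D \<omega> \<bullet> yh \<noteq> hvec D \<omega> \<bullet> y;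
       (x, yh) \<notin> frontier (Sset D \<omega>) \<rbrakk>
     \<Longrightarrow> sub_alg_cuts D \<omega> x (insert k cuts)"
| fixed_boundary:
    "\<lbrakk> sub_alg_cuts D \<omega> x cuts; bb_solves D \<omega> x cuts y t; (x, y) \<notin> Sset D \<omega>;
       projection_cut D \<omega> x y k; fixed_optimal D \<omega> x y yh; hvec D \<omega> \<bullet> yh \<noteq> hvec D \<omega> \<bullet> y;
       (x, yh) \<in> frontier (Sset D \<omega>); normal_cut D \<omega> x y yh k' \<rbrakk>
     \<Longrightarrow> sub_alg_cuts D \<omega> x (insert k' (insert k cuts))"

text \<open>\<open>Optimal y \<L>\<close>: returned solution and the leaves of the tree of the last master problem.\<close>

datatype ('x, 'y) sub_alg_result =
  Infeasible
| Optimal "real^('y::finite)" "('x::finite, 'y) lincon set set"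

inductive sub_alg ::
  "('x::finite,'y::finite,'w::finite,'e::finite,'m::finite,'i) problem \<Rightarrow> 'w \<Rightarrow> real^'x \<Rightarrow> ('x,'y) sub_alg_result \<Rightarrow> bool"
  for D \<omega> x where
  claim_infeasible:
    "\<lbrakk> sub_alg_cuts D \<omega> x cuts; milp_feasible D \<omega> x cuts = {} \<rbrakk> \<Longrightarrow> sub_alg D \<omega> x Infeasible"
| return_master:
    "\<lbrakk> sub_alg_cuts D \<omega> x cuts; bb_solves D \<omega> x cuts y t; (x, y) \<in> Sset D \<omega> \<rbrakk>
     \<Longrightarrow> sub_alg D \<omega> x (Optimal y (bb_leaves t (master_cons D \<omega> cuts)))"
| return_fixed:
    "\<lbrakk> sub_alg_cuts D \<omega> x cuts; bb_solves D \<omega> x cuts y t; (x, y) \<notin> Sset D \<omega>;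
       projection_cut D \<omega> x y k; fixed_optimal D \<omega> x y yh; hvec D \<omega> \<bullet> yh = hvec D \<omega> \<bullet> y \<rbrakk>
     \<Longrightarrow> sub_alg D \<omega> x (Optimal yh (bb_leaves t (master_cons D \<omega> cuts)))"


section \<open>The decomposition linearize-branch-and-union algorithm\<close>

text \<open>
  \<open>benders\<close> holds the pairs \<open>(\<lambda>, \<sigma>)\<close> of the cuts \<open>\<eta> \<ge> \<lambda> \<bullet> x + \<sigma>\<close> and \<open>excluded\<close> the binary points for
  which a feasibility cut was added; \<open>incumbent\<close> is the current best solution, \<open>None\<close> as long as
  there is none.  A master solution becomes the current best one when it improves \<open>upper\<close>: if it did
  so unconditionally, then a tie in the last master problem could make the algorithm return a
  point that attains \<open>lower\<close> in the master problem without being optimal.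
\<close>

record 'x master_state =
  lower :: ereal
  upper :: ereal
  incumbent :: "(real^('x::finite)) option"
  benders :: "((real^('x::finite)) \<times> real) set"
  excluded :: "(real^('x::finite)) set"

definition initial_state :: "'x::finite master_state" where
  "initial_state = \<lparr>lower = -\<infinity>, upper = \<infinity>, incumbent = None, benders = {}, excluded = {}\<rparr>"

definition feasibility_cut :: "real^'x::finite \<Rightarrow> real^'x \<Rightarrow> bool" where
  "feasibility_cut xm x \<longleftrightarrow> (\<Sum>j | xm $ j = 0. x $ j) + (\<Sum>j | xm $ j = 1. 1 - x $ j) \<ge> 1"

text \<open>
  The variable \<open>\<eta>\<close> is extended-real: as long as there is no Benders' cut, every feasible \<open>x\<close> is
  optimal, together with \<open>\<eta> = -\<infinity>\<close>.  (With a real \<open>\<eta>\<close> the first master problem would be unbounded.)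
\<close>

definition master_feasible ::
  "('x::finite,'y::finite,'w::finite,'e::finite,'m::finite,'i) problem \<Rightarrow> 'x master_state \<Rightarrow> ((real^'x) \<times> ereal) set" where
  "master_feasible D st =
     {(x, \<eta>). x \<in> first_stage D \<and> (\<forall>(l, s)\<in>benders st. \<eta> \<ge> ereal (l \<bullet> x + s)) \<and>
        (\<forall>xm\<in>excluded st. feasibility_cut xm x)}"

definition master_optimal ::
  "('x::finite,'y::finite,'w::finite,'e::finite,'m::finite,'i) problem \<Rightarrow> 'x master_state \<Rightarrow> (real^'x) \<times> ereal \<Rightarrow> bool" where
  "master_optimal D st =
     is_arg_min (\<lambda>(x, \<eta>). ereal (cvec D \<bullet> x) + \<eta>) (\<lambda>v. v \<in> master_feasible D st)"

text \<open>
  \<open>Loop st\<close>: the while-condition is about to be tested.  \<open>Scenarios st x done\<close>: within the loop over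
  the scenarios at the master solution \<open>x\<close>, \<open>done\<close> recording the \<open>(\<lambda>, \<sigma>)\<close> of the scenarios already
  treated.  \<open>Subproblem st x done \<omega>\<close>: the sub-problem algorithm has been called for \<open>Sub(x, \<omega>)\<close>.
\<close>

datatype ('x, 'w) decomp_state =
  Loop "('x::finite) master_state"
| Scenarios "('x::finite) master_state" "real^('x::finite)" "'w \<rightharpoonup> (real^('x::finite)) \<times> real"
| Subproblem "('x::finite) master_state" "real^('x::finite)" "'w \<rightharpoonup> (real^('x::finite)) \<times> real" 'w
| Returned "real^('x::finite)"
| Claimed_Infeasible

inductive decomp_step ::
  "('x::finite,'y::finite,'w::finite,'e::finite,'m::finite,'i) problem \<Rightarrow> ('x,'w) decomp_state \<Rightarrow> ('x,'w) decomp_state \<Rightarrow> bool"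
  for D where
  return_best:
    "\<lbrakk> \<not> upper st - lower st > 0; incumbent st = Some x \<rbrakk>
     \<Longrightarrow> decomp_step D (Loop st) (Returned x)"
| master_infeasible:
    "\<lbrakk> upper st - lower st > 0; master_feasible D st = {} \<rbrakk>
     \<Longrightarrow> decomp_step D (Loop st) Claimed_Infeasible"
| master_solved:
    "\<lbrakk> upper st - lower st > 0; master_optimal D st (x, \<eta>) \<rbrakk>
     \<Longrightarrow> decomp_step D (Loop st) (Scenarios (st\<lparr>lower := ereal (cvec D \<bullet> x) + \<eta>\<rparr>) x Map.empty)"
| call_sub_alg:
    "done \<omega> = None \<Longrightarrow> decomp_step D (Scenarios st x done) (Subproblem st x done \<omega>)"
| sub_infeasible:
    "sub_alg D \<omega> x Infeasible
     \<Longrightarrow> decomp_step D (Subproblem st x done \<omega>) (Loop (st\<lparr>excluded := insert x (excluded st)\<rparr>))"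
| sub_optimal:
    "\<lbrakk> sub_alg D \<omega> x (Optimal y \<L>);
       \<forall>\<nu>\<in>\<L>. leaf_duals D \<omega> x (hvec D \<omega> \<bullet> y) \<nu> (duals \<nu>);
       cut_lp_optimal D \<omega> x \<L> duals (l, s, \<beta>, \<gamma>) \<rbrakk>
     \<Longrightarrow> decomp_step D (Subproblem st x done \<omega>) (Scenarios st x (done(\<omega> \<mapsto> (l, s))))"
| add_benders:
    "\<lbrakk> \<forall>\<omega>. done \<omega> = Some (lam \<omega>, sig \<omega>);
       is_arg_max (expected_recourse D x) (\<lambda>p. p \<in> Pset D) p;
       val = ereal (cvec D \<bullet> x) + expected_recourse D x p \<rbrakk>
     \<Longrightarrow> decomp_step D (Scenarios st x done)
           (Loop (st\<lparr>benders := insert (\<Sum>\<omega>\<in>UNIV. p $ \<omega> *\<^sub>R lam \<omega>, \<Sum>\<omega>\<in>UNIV. p $ \<omega> * sig \<omega>) (benders st),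
                     incumbent := (if val < upper st then Some x else incumbent st),
                     upper := min (upper st) val\<rparr>))"

text \<open>A maximal execution; a state without successor (final, or stuck) is repeated forever.\<close>

definition decomp_execution ::
  "('x::finite,'y::finite,'w::finite,'e::finite,'m::finite,'i) problem \<Rightarrow> (nat \<Rightarrow> ('x,'w) decomp_state) \<Rightarrow> bool" where
  "decomp_execution D s \<longleftrightarrow>
     s 0 = Loop initial_state \<and>
     (\<forall>n. decomp_step D (s n) (s (Suc n)) \<or> (\<nexists>t. decomp_step D (s n) t) \<and> s (Suc n) = s n)"

definition masters_solved ::
  "('x::finite,'y::finite,'w::finite,'e::finite,'m::finite,'i) problem \<Rightarrow> (nat \<Rightarrow> ('x,'w) decomp_state) \<Rightarrow> bool" where
  "masters_solved D s \<longleftrightarrow>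
     (\<forall>n st. s n = Loop st \<longrightarrow> upper st - lower st > 0 \<longrightarrow>
        master_feasible D st = {} \<or> (\<exists>x \<eta>. master_optimal D st (x, \<eta>)))"

definition subproblems_solved ::
  "('x::finite,'y::finite,'w::finite,'e::finite,'m::finite,'i) problem \<Rightarrow> (nat \<Rightarrow> ('x,'w) decomp_state) \<Rightarrow> bool" where
  "subproblems_solved D s \<longleftrightarrow>
     (\<forall>n st x done \<omega>. s n = Subproblem st x done \<omega> \<longrightarrow> (\<exists>res. sub_alg D \<omega> x res))"


section \<open>Constraint functions occurring in an execution\<close>

text \<open>In \<open>(x, \<eta>)\<close>-form for the first-stage master problems, in \<open>(x, y)\<close>-form for the second stage.\<close>

definition first_stage_constraint_funs ::
  "('x::finite,'y::finite,'w::finite,'e::finite,'m::finite,'i) problem \<Rightarrow> (nat \<Rightarrow> ('x,'w) decomp_state) \<Rightarrow>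
   ((real^'x) \<times> real \<Rightarrow> real) set" where
  "first_stage_constraint_funs D s =
     {\<lambda>(x, \<eta>). (Amat D *v x - bvec D) $ r | r. True} \<union>
     {\<lambda>(x, \<eta>). l \<bullet> x + \<sigma> - \<eta> | l \<sigma>. \<exists>n st. s n = Loop st \<and> (l, \<sigma>) \<in> benders st} \<union>
     {\<lambda>(x, \<eta>). 1 - ((\<Sum>j | xm $ j = 0. x $ j) + (\<Sum>j | xm $ j = 1. 1 - x $ j)) | xm.
        \<exists>n st. s n = Loop st \<and> xm \<in> excluded st}"

definition second_stage_constraint_funs ::
  "('x::finite,'y::finite,'w::finite,'e::finite,'m::finite,'i) problem \<Rightarrow> (nat \<Rightarrow> ('x,'w) decomp_state) \<Rightarrow>
   ((real^'x) \<times> (real^'y) \<Rightarrow> real) set" where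
  "second_stage_constraint_funs D s =
     {gfun D \<omega> i | \<omega> i. i \<in> Iset D} \<union>
     {\<lambda>(x, y). (Tmat D \<omega> *v x + Wmat D \<omega> *v y - qvec D \<omega>) $ r | \<omega> r. True} \<union>
     {\<lambda>(x, y). (qvec D \<omega> - (Tmat D \<omega> *v x + Wmat D \<omega> *v y)) $ r | \<omega> r. True} \<union>
     {lin_fun k | k. \<exists>n st x done \<omega> cuts. s n = Subproblem st x done \<omega> \<and> sub_alg_cuts D \<omega> x cuts \<and>
        (k \<in> master_cons D \<omega> cuts \<or>
         (\<exists>y t. bb_solves D \<omega> x cuts y t \<and> k \<in> \<Union>(bb_leaves t (master_cons D \<omega> cuts))))}"

definition constraint_funs_in_collection ::
  "function_collection \<Rightarrow> ('x::finite,'y::finite,'w::finite,'e::finite,'m::finite,'i) problem \<Rightarrow>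
   (nat \<Rightarrow> ('x,'w) decomp_state) \<Rightarrow> bool" where
  "constraint_funs_in_collection F D s \<longleftrightarrow>
     (\<forall>f\<in>first_stage_constraint_funs D s. belongs_to F f) \<and>
     (\<forall>f\<in>second_stage_constraint_funs D s. belongs_to F f)"

end

theory Submission
  imports Defs
begin

text \<open>
  A scenario cut is a lower bound on the recourse function at every binary point, because the leaves of
  the tree cover all integral solutions of the master problem and dual solutions of a leaf stay
  feasible when \<open>x\<close> changes; it is exact at the point where it was generated.  Hence the first-stage
  master problem is always a relaxation, and a second Benders' iteration at the same binary point
  closes the gap.  As an infeasible point is excluded forever and there are finitely many binary
  points, the algorithm terminates.

  The point that needs an argument beyond bookkeeping is that no iteration gets stuck: dual vectors
  reaching the cutoff value exist even at infeasible leaves (Farkas' lemma, with the boundedness of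
  \<open>\<Y>\<^sup>\<omega>\<close> making the recession cone trivial), and the cut-generating linear program has an optimal
  solution.
\<close>

subsection \<open>Linear programming duality\<close>

text \<open>The nonnegative combinations form a convex cone containing the generators, so they
  contain the hull. Indexing by \<open>I\<close> instead of by the image keeps one multiplier per
  constraint even when two constraints share a vector.\<close>

lemma convex_cone_hull_image_finite:
  fixes f :: "'k \<Rightarrow> 'a::euclidean_space"
  assumes "finite I" and "z \<in> convex_cone hull (f ` I)"
  shows "\<exists>\<mu>. (\<forall>i\<in>I. 0 \<le> \<mu> i) \<and> z = (\<Sum>i\<in>I. \<mu> i *\<^sub>R f i)"
proof -
  let ?C = "{z. \<exists>\<mu>. (\<forall>i\<in>I. 0 \<le> \<mu> i) \<and> z = (\<Sum>i\<in>I. \<mu> i *\<^sub>R f i)}"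
  have "convex_cone hull (f ` I) \<subseteq> ?C"
  proof (rule hull_minimal)
    show "f ` I \<subseteq> ?C"
    proof clarify
      fix i assume "i \<in> I"
      then have "f i = (\<Sum>j\<in>I. (if j = i then 1 else 0) *\<^sub>R f j)"
        using assms(1) by (simp add: if_distrib [of "\<lambda>c. c *\<^sub>R _"] cong: if_cong)
      then show "\<exists>\<mu>. (\<forall>j\<in>I. 0 \<le> \<mu> j) \<and> f i = (\<Sum>j\<in>I. \<mu> j *\<^sub>R f j)"
        by (intro exI [of _ "\<lambda>j. if j = i then 1 else 0"]) auto
    qed
    show "convex_cone ?C"
      unfolding convex_cone_iff
    proof (intro conjI ballI allI impI)
      show "0 \<in> ?C"
        by (auto intro!: exI [of _ "\<lambda>_. 0"])
    next
      fix u v assume "u \<in> ?C" "v \<in> ?C"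
      then obtain \<mu> \<mu>' where "\<forall>i\<in>I. 0 \<le> \<mu> i" "u = (\<Sum>i\<in>I. \<mu> i *\<^sub>R f i)"
        "\<forall>i\<in>I. 0 \<le> \<mu>' i" "v = (\<Sum>i\<in>I. \<mu>' i *\<^sub>R f i)" by auto
      then show "u + v \<in> ?C"
        by (auto intro!: exI [of _ "\<lambda>i. \<mu> i + \<mu>' i"] simp: scaleR_add_left sum.distrib)
    next
      fix u and c :: real assume "u \<in> ?C" "c \<ge> 0"
      then obtain \<mu> where "\<forall>i\<in>I. 0 \<le> \<mu> i" "u = (\<Sum>i\<in>I. \<mu> i *\<^sub>R f i)" by auto
      then show "c *\<^sub>R u \<in> ?C"
        using \<open>c \<ge> 0\<close> by (auto intro!: exI [of _ "\<lambda>i. c * \<mu> i"] simp: scaleR_sum_right)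
    qed
  qed
  then show ?thesis using assms(2) by auto
qed

text \<open>A finitely generated cone is polyhedral, hence closed, so a point outside it can be
  strictly separated; the negated normal of the separating hyperplane contradicts the
  hypothesis.\<close>

lemma farkas_cone:
  fixes f :: "'k \<Rightarrow> 'a::euclidean_space"
  assumes "finite I" and "\<And>a. (\<And>i. i \<in> I \<Longrightarrow> a \<bullet> f i \<le> 0) \<Longrightarrow> a \<bullet> z \<le> 0"
  shows "\<exists>\<mu>. (\<forall>i\<in>I. 0 \<le> \<mu> i) \<and> z = (\<Sum>i\<in>I. \<mu> i *\<^sub>R f i)"
proof (rule convex_cone_hull_image_finite [OF assms(1)], rule ccontr)
  let ?C = "convex_cone hull (f ` I)"
  assume "z \<notin> ?C"
  moreover have "closed ?C"
    using assms(1) by (intro polyhedron_imp_closed polyhedron_convex_cone_hull) simp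
  ultimately obtain a b where ab: "a \<bullet> z < b" "\<And>v. v \<in> ?C \<Longrightarrow> b < a \<bullet> v"
    using separating_hyperplane_closed_point [OF convex_convex_cone_hull] by blast
  have "b < 0"
    using ab(2) [OF convex_cone_hull_contains_0] by simp
  have "0 \<le> a \<bullet> f i" if "i \<in> I" for i
  proof (rule ccontr)
    assume neg: "\<not> 0 \<le> a \<bullet> f i"
    \<comment> \<open>The factor is nonnegative, as both \<open>b\<close> and the inner product are
      negative, and it places the point exactly on the separating hyperplane.\<close>
    have "(b / (a \<bullet> f i)) *\<^sub>R f i \<in> ?C"
      using that neg \<open>b < 0\<close> by (intro convex_cone_hull_mul hull_inc) (auto simp: divide_nonpos_neg)
    then show False
      using ab(2) neg by fastforce
  qed
  then have "(- a) \<bullet> z \<le> 0"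
    by (intro assms(2)) simp
  then show False
    using ab(1) \<open>b < 0\<close> by simp
qed

text \<open>
  As the recession cone is trivial, \<open>v\<close> need not be a bound that is attained, and the system may even
  be infeasible (the bound is then vacuous).
\<close>

lemma farkas_bounded:
  fixes q :: "'k \<Rightarrow> 'a::euclidean_space" and t :: "'k \<Rightarrow> real"
  assumes "finite I"
    and recession: "\<And>a. (\<And>i. i \<in> I \<Longrightarrow> q i \<bullet> a \<le> 0) \<Longrightarrow> a = 0"
    and bound: "\<And>y. (\<And>i. i \<in> I \<Longrightarrow> q i \<bullet> y + t i \<le> 0) \<Longrightarrow> v \<le> h \<bullet> y"
  shows "\<exists>\<mu>. (\<forall>i\<in>I. 0 \<le> \<mu> i) \<and> (\<Sum>i\<in>I. \<mu> i *\<^sub>R q i) = - h \<and> v \<le> (\<Sum>i\<in>I. \<mu> i * t i)"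
proof -
  \<comment> \<open>Homogenisation: the right-hand sides become an extra coordinate. The generator
    \<open>(0, - 1)\<close> provides the slack that turns an equation for \<open>v\<close> into the
    desired inequality, and it forces \<alpha> \<ge> 0 below.\<close>
  define f where "f = (\<lambda>j. case j of None \<Rightarrow> (0, - 1) | Some i \<Rightarrow> (q i, t i))"
  have "\<exists>\<mu>. (\<forall>j\<in>insert None (Some ` I). 0 \<le> \<mu> j) \<and>
      (- h, v) = (\<Sum>j\<in>insert None (Some ` I). \<mu> j *\<^sub>R f j)"
  proof (rule farkas_cone)
    fix a :: "'a \<times> real"
    assume le: "\<And>j. j \<in> insert None (Some ` I) \<Longrightarrow> a \<bullet> f j \<le> 0"
    obtain b \<alpha> where a: "a = (b, \<alpha>)" by force
    have b: "q i \<bullet> b + t i * \<alpha> \<le> 0" if "i \<in> I" for i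
      using le [of "Some i"] that by (simp add: a f_def inner_commute mult.commute)
    have "0 \<le> \<alpha>"
      using le [of None] by (simp add: a f_def)
    show "a \<bullet> (- h, v) \<le> 0"
    \<comment> \<open>For \<alpha> = 0 the vector \<open>b\<close> is a recession direction, hence
      zero; for \<alpha> > 0 rescaling by \<alpha> gives a feasible point, to which the bound
      applies.\<close>
    proof (cases "\<alpha> = 0")
      case True
      then have "b = 0"
        using b by (intro recession) simp
      then show ?thesis
        using True by (simp add: a)
    next
      case False
      then have pos: "0 < \<alpha>"
        using \<open>0 \<le> \<alpha>\<close> by simp
      have "v \<le> h \<bullet> (b /\<^sub>R \<alpha>)"
      proof (rule bound)
        fix i assume "i \<in> I"
        then show "q i \<bullet> (b /\<^sub>R \<alpha>) + t i \<le> 0"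
          using b pos by (simp add: field_simps)
      qed
      then show ?thesis
        using pos by (simp add: a inner_commute field_simps)
    qed
  qed (use assms(1) in simp)
  then obtain \<mu> where nonneg: "\<And>j. j \<in> insert None (Some ` I) \<Longrightarrow> 0 \<le> \<mu> j"
    and eq: "(- h, v) = (\<Sum>j\<in>insert None (Some ` I). \<mu> j *\<^sub>R f j)" by blast
  have "(\<Sum>j\<in>insert None (Some ` I). \<mu> j *\<^sub>R f j) =
      (\<Sum>i\<in>I. \<mu> (Some i) *\<^sub>R q i, (\<Sum>i\<in>I. \<mu> (Some i) * t i) - \<mu> None)"
    using assms(1) by (simp add: sum.reindex f_def sum_prod[symmetric] fst_sum snd_sum prod_eq_iff)
  then show ?thesis
    using eq nonneg by (intro exI [of _ "\<lambda>i. \<mu> (Some i)"]) auto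
qed

text \<open>Each equation is written as two opposite inequalities, tagged by a boolean; the
  sign-free multiplier \<theta> is the difference of their two multipliers.\<close>

lemma farkas_bounded_eq:
  fixes q :: "'k \<Rightarrow> real^'n::finite" and W :: "real^'n^'e::finite"
  assumes "finite K"
    and recession: "\<And>a. (\<And>k. k \<in> K \<Longrightarrow> q k \<bullet> a \<le> 0) \<Longrightarrow> a = 0"
    and bound: "\<And>y. W *v y = w \<Longrightarrow> (\<And>k. k \<in> K \<Longrightarrow> q k \<bullet> y + t k \<le> 0) \<Longrightarrow> v \<le> h \<bullet> y"
  shows "\<exists>\<theta> \<mu>. (\<forall>k\<in>K. 0 \<le> \<mu> k) \<and> transpose W *v \<theta> - (\<Sum>k\<in>K. \<mu> k *\<^sub>R q k) = h \<and>
           v \<le> \<theta> \<bullet> w + (\<Sum>k\<in>K. \<mu> k * t k)"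
proof -
  define q' where "q' = case_sum q (\<lambda>(e, b). if b then row e W else - row e W)"
  define t' where "t' = case_sum t (\<lambda>(e, b). if b then - (w $ e) else w $ e)"
  have split: "(\<Sum>i\<in>K <+> UNIV. g i) = (\<Sum>k\<in>K. g (Inl k)) + (\<Sum>e\<in>UNIV. g (Inr (e, True)) + g (Inr (e, False)))"
    for g :: "'k + 'e \<times> bool \<Rightarrow> 'b::ab_group_add"
    using assms(1) by (simp add: sum.Plus sum.cartesian_product' UNIV_bool add.commute flip: UNIV_Times_UNIV)
  have row: "row e W \<bullet> y = (W *v y) $ e" for e y
    by (simp add: matrix_vector_mul_component row_def vec_lambda_eta)
  have "\<exists>\<mu>. (\<forall>i\<in>K <+> UNIV. 0 \<le> \<mu> i) \<and> (\<Sum>i\<in>K <+> UNIV. \<mu> i *\<^sub>R q' i) = - h \<and>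
      v \<le> (\<Sum>i\<in>K <+> UNIV. \<mu> i * t' i)"
  proof (rule farkas_bounded)
    fix a assume "\<And>i. i \<in> K <+> UNIV \<Longrightarrow> q' i \<bullet> a \<le> 0"
    then have "q' (Inl k) \<bullet> a \<le> 0" if "k \<in> K" for k
      using that by blast
    then show "a = 0"
      by (intro recession) (simp add: q'_def)
  next
    fix y assume le: "\<And>i. i \<in> K <+> UNIV \<Longrightarrow> q' i \<bullet> y + t' i \<le> 0"
    show "v \<le> h \<bullet> y"
    proof (rule bound)
      show "W *v y = w"
      proof (rule vec_eq_iff [THEN iffD2], rule allI)
        fix e
        show "(W *v y) $ e = w $ e"
          using le [OF InrI, of "(e, True)"] le [OF InrI, of "(e, False)"] by (simp add: q'_def t'_def row)
      qed
    qed (use le [OF InlI] in \<open>simp add: q'_def t'_def\<close>)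
  qed (use assms(1) in simp)
  then obtain \<mu> where \<mu>: "\<forall>i\<in>K <+> UNIV. 0 \<le> \<mu> i" "(\<Sum>i\<in>K <+> UNIV. \<mu> i *\<^sub>R q' i) = - h"
    "v \<le> (\<Sum>i\<in>K <+> UNIV. \<mu> i * t' i)" by (elim exE conjE)
  \<comment> \<open>The order of the difference comes from the sign convention: the inequality
    multipliers sum to \<open>- h\<close>, whereas \<theta> enters the dual constraint with a plus
    sign.\<close>
  define \<theta> :: "real^'e" where "\<theta> = (\<chi> e. \<mu> (Inr (e, False)) - \<mu> (Inr (e, True)))"
  have "transpose W *v \<theta> = (\<Sum>e\<in>UNIV. \<theta> $ e *\<^sub>R row e W)"
    by (simp add: matrix_mult_sum scalar_mult_eq_scaleR)
  then have "transpose W *v \<theta> - (\<Sum>k\<in>K. \<mu> (Inl k) *\<^sub>R q k) = - (\<Sum>i\<in>K <+> UNIV. \<mu> i *\<^sub>R q' i)"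
    unfolding split by (simp add: q'_def \<theta>_def algebra_simps sum.distrib sum_subtractf sum_negf)
  moreover have "\<theta> \<bullet> w + (\<Sum>k\<in>K. \<mu> (Inl k) * t k) = (\<Sum>i\<in>K <+> UNIV. \<mu> i * t' i)"
    unfolding split by (simp add: t'_def \<theta>_def inner_vec_def algebra_simps sum.distrib sum_subtractf sum_negf)
  ultimately show ?thesis
    using \<mu> by (intro exI [of _ \<theta>] exI [of _ "\<lambda>k. \<mu> (Inl k)"]) auto
qed

subsection \<open>Leaf linear programs\<close>

lemma lp_feasible_antimono: "K \<subseteq> K' \<Longrightarrow> lp_feasible D \<omega> x K' \<subseteq> lp_feasible D \<omega> x K"
  by (auto simp: lp_feasible_def)

lemma bb_leaves_superset: "\<nu> \<in> bb_leaves t K \<Longrightarrow> K \<subseteq> \<nu>"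
  by (induction t arbitrary: K) fastforce+

lemma finite_bb_leaf: "\<nu> \<in> bb_leaves t K \<Longrightarrow> finite K \<Longrightarrow> finite \<nu>"
  by (induction t arbitrary: K) fastforce+

lemma finite_bb_leaves: "finite (bb_leaves t K)"
  by (induction t arbitrary: K) auto

text \<open>An integral value of the branching variable satisfies one of the two branch bounds, so
  descending from the root reaches a leaf. The bounds do not involve \<open>x\<close>, which lets a
  tree built at one first-stage point cover the solutions at another.\<close>

lemma bb_leaves_cover:
  assumes "y \<in> lp_feasible D \<omega> x K" "integral_part D y" "branch_vars t \<subseteq> Jint D"
  shows "\<exists>\<nu>\<in>bb_leaves t K. y \<in> lp_feasible D \<omega> x \<nu>"
  using assms
proof (induction t arbitrary: K)
  case (Branch j k l r)
  then have "y $ j \<in> \<int>" by (simp add: integral_part_def)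
  then obtain z where z: "y $ j = of_int z" by (elim Ints_cases)
  consider "z \<le> k" | "k + 1 \<le> z" by linarith
  then show ?case
  proof cases
    case 1
    then have "y \<in> lp_feasible D \<omega> x (insert (0, axis j 1, - of_int k) K)"
      using Branch.prems z by (simp add: lp_feasible_def lin_fun_def inner_axis')
    from Branch.IH(1) [OF this] show ?thesis
      using Branch.prems by auto
  next
    case 2
    then have "real_of_int k + 1 \<le> of_int z" by linarith
    then have "y \<in> lp_feasible D \<omega> x (insert (0, - axis j 1, of_int k + 1) K)"
      using Branch.prems z by (simp add: lp_feasible_def lin_fun_def inner_axis')
    from Branch.IH(2) [OF this] show ?thesis
      using Branch.prems by auto
  qed
qed auto

text \<open>Weighting the constraints by the dual vectors reproduces the objective. Dual feasibility
  does not depend on \<open>x\<close>, so vectors computed at one point bound the leaf program at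
  every other.\<close>

lemma leaf_weak_duality:
  assumes "leaf_dual_feasible D \<omega> K d" and "y \<in> lp_feasible D \<omega> x K"
  shows "leaf_dual_value D \<omega> x K d \<le> hvec D \<omega> \<bullet> y"
proof -
  obtain \<theta> \<mu> where d: "d = (\<theta>, \<mu>)" by force
  have nonneg: "\<forall>k\<in>K. 0 \<le> \<mu> k"
    and h: "hvec D \<omega> = transpose (Wmat D \<omega>) *v \<theta> - (\<Sum>(r, q, s)\<in>K. \<mu> (r, q, s) *\<^sub>R q)"
    using assms(1) by (auto simp: leaf_dual_feasible_def d)
  have W: "Wmat D \<omega> *v y = qvec D \<omega> - Tmat D \<omega> *v x"
    using assms(2) by (auto simp: lp_feasible_def algebra_simps)
  have "(\<Sum>(r, q, s)\<in>K. \<mu> (r, q, s) * (r \<bullet> x + s)) \<le> (\<Sum>(r, q, s)\<in>K. - (\<mu> (r, q, s) * (q \<bullet> y)))"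
  proof (rule sum_mono, clarify)
    fix r q s assume k: "(r, q, s) \<in> K"
    then have "\<mu> (r, q, s) * (r \<bullet> x + q \<bullet> y + s) \<le> 0"
      using nonneg assms(2) by (auto simp: lp_feasible_def lin_fun_def mult_nonneg_nonpos)
    then show "\<mu> (r, q, s) * (r \<bullet> x + s) \<le> - (\<mu> (r, q, s) * (q \<bullet> y))"
      by (simp add: algebra_simps)
  qed
  also have "\<dots> = - ((\<Sum>(r, q, s)\<in>K. \<mu> (r, q, s) *\<^sub>R q) \<bullet> y)"
    by (simp add: inner_sum_left sum_negf case_prod_unfold)
  finally show ?thesis
    by (simp add: leaf_dual_value_def d h inner_diff_left dot_lmul_matrix W)
qed

text \<open>Exhibits the slope and the constant term in \<open>x\<close> against which the
  cut-generating linear program compares its cut.\<close>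

lemma leaf_dual_value_affine:
  "leaf_dual_value D \<omega> x K (\<theta>, \<mu>) =
     ((\<Sum>(r, q, s)\<in>K. \<mu> (r, q, s) *\<^sub>R r) - transpose (Tmat D \<omega>) *v \<theta>) \<bullet> x +
     ((\<Sum>(r, q, s)\<in>K. \<mu> (r, q, s) * s) + \<theta> \<bullet> qvec D \<omega>)"
  by (simp add: leaf_dual_value_def inner_diff_left inner_diff_right inner_sum_left dot_lmul_matrix
      case_prod_unfold distrib_left sum.distrib)


subsection \<open>The cut-generating linear program\<close>

text \<open>\<beta> and \<gamma> are multipliers of \<open>A x \<le> b\<close> and
  \<open>x \<le> 1\<close>, and the first inequality is paired with \<open>x \<ge> 0\<close>. The
  constraints thus certify, by weak duality, that the cut lies below the affine dual value of the
  leaf.\<close>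

lemma cut_lp_feasible_bound:
  assumes "cut_lp_feasible D \<omega> \<L> duals (l, \<sigma>, \<beta>, \<gamma>)" and "\<nu> \<in> \<L>"
    and "x \<in> Xset D" and "binary x"
  shows "l \<bullet> x + \<sigma> \<le> leaf_dual_value D \<omega> x \<nu> (duals \<nu>)"
proof -
  obtain \<theta> \<mu> where d: "duals \<nu> = (\<theta>, \<mu>)" by force
  define c where "c = (\<Sum>(r, q, s)\<in>\<nu>. \<mu> (r, q, s) *\<^sub>R r) - transpose (Tmat D \<omega>) *v \<theta>"
  have x01: "0 \<le> x $ j" "x $ j \<le> 1" for j
    using assms(4) by (auto simp: binary_def dest: spec [of _ j])
  have l: "(l - c - transpose (Amat D) *v \<beta> \<nu> - \<gamma> \<nu>) $ j \<le> 0"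
    and \<sigma>: "\<sigma> - (\<Sum>(r, q, s)\<in>\<nu>. \<mu> (r, q, s) * s) - \<theta> \<bullet> qvec D \<omega> + \<beta> \<nu> \<bullet> bvec D + \<gamma> \<nu> \<bullet> 1 \<le> 0"
    and \<beta>: "0 \<le> \<beta> \<nu> $ i" and \<gamma>: "0 \<le> \<gamma> \<nu> $ j" for i j
    using assms(1,2) d by (fastforce simp: cut_lp_feasible_def c_def algebra_simps)+
  have "(l - c - transpose (Amat D) *v \<beta> \<nu> - \<gamma> \<nu>) \<bullet> x \<le> 0"
    unfolding inner_vec_def inner_real_def using l x01 by (intro sum_nonpos mult_nonpos_nonneg) auto
  moreover have "\<beta> \<nu> \<bullet> (Amat D *v x) \<le> \<beta> \<nu> \<bullet> bvec D"
    unfolding inner_vec_def inner_real_def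
    using \<beta> assms(3) by (intro sum_mono mult_left_mono) (auto simp: Xset_def)
  moreover have "\<gamma> \<nu> \<bullet> x \<le> \<gamma> \<nu> \<bullet> 1"
    unfolding inner_vec_def inner_real_def
    using \<gamma> x01 by (intro sum_mono mult_left_mono) auto
  ultimately show ?thesis
    using \<sigma> unfolding d leaf_dual_value_affine c_def [symmetric]
    by (simp add: inner_diff_left dot_lmul_matrix)
qed

text \<open>
  The witness uses that \<open>x\<close> is binary: it is the cut \<open>v - M \<Delta>(\<cdot>, x)\<close> for the Hamming distance
  \<open>\<Delta>\<close> and a large constant \<open>M\<close>.
\<close>

lemma cut_lp_feasible_tight:
  assumes "finite \<L>" and "binary x"
    and le: "\<And>\<nu>. \<nu> \<in> \<L> \<Longrightarrow> v \<le> leaf_dual_value D \<omega> x \<nu> (duals \<nu>)"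
  shows "\<exists>l \<sigma> \<beta> \<gamma>. cut_lp_feasible D \<omega> \<L> duals (l, \<sigma>, \<beta>, \<gamma>) \<and> l \<bullet> x + \<sigma> = v"
proof -
  define c where "c = (\<lambda>\<nu>. let (\<theta>, \<mu>) = duals \<nu> in
    (\<Sum>(r, q, s)\<in>\<nu>. \<mu> (r, q, s) *\<^sub>R r) - transpose (Tmat D \<omega>) *v \<theta>)"
  \<comment> \<open>This sum dominates every coordinate of the slope of every leaf.\<close>
  define M where "M = (\<Sum>\<nu>\<in>\<L>. \<Sum>j\<in>UNIV. \<bar>c \<nu> $ j\<bar>)"
  define l :: "real^'a" where "l = (\<chi> j. if x $ j = 1 then M else - M)"
  \<comment> \<open>Where \<open>x $ j = 1\<close>, \<gamma> absorbs the whole excess of the cut's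
    slope over the leaf's, nonnegative by the choice of \<open>M\<close>; elsewhere it vanishes and
    the slope \<open>- M\<close> suffices.\<close>
  define \<gamma> :: "_ \<Rightarrow> real^'a" where "\<gamma> = (\<lambda>\<nu>. \<chi> j. x $ j * (l $ j - c \<nu> $ j))"
  have x01: "x $ j = 0 \<or> x $ j = 1" for j
    using assms(2) by (simp add: binary_def)
  have M: "\<bar>c \<nu> $ j\<bar> \<le> M" if "\<nu> \<in> \<L>" for \<nu> j
  proof -
    have "\<bar>c \<nu> $ j\<bar> \<le> (\<Sum>j\<in>UNIV. \<bar>c \<nu> $ j\<bar>)"
      by (rule member_le_sum) auto
    also have "\<dots> \<le> M"
      unfolding M_def using that assms(1) by (intro member_le_sum [of \<nu>]) (auto intro: sum_nonneg)
    finally show ?thesis .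
  qed
  have "cut_lp_feasible D \<omega> \<L> duals (l, v - l \<bullet> x, \<lambda>_. 0, \<gamma>)"
    unfolding cut_lp_feasible_def prod.case
  proof (intro ballI)
    fix \<nu> assume \<nu>: "\<nu> \<in> \<L>"
    obtain \<theta> \<mu> where d: "duals \<nu> = (\<theta>, \<mu>)" by force
    have c: "c \<nu> = (\<Sum>(r, q, s)\<in>\<nu>. \<mu> (r, q, s) *\<^sub>R r) - transpose (Tmat D \<omega>) *v \<theta>"
      by (simp add: c_def d)
    have "l $ j - c \<nu> $ j - \<gamma> \<nu> $ j \<le> 0" "0 \<le> \<gamma> \<nu> $ j" for j
      using M [OF \<nu>, of j] x01 [of j] by (auto simp: \<gamma>_def l_def)
    moreover have "\<gamma> \<nu> \<bullet> 1 = l \<bullet> x - c \<nu> \<bullet> x"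
      by (simp add: \<gamma>_def inner_vec_def algebra_simps sum_subtractf)
    moreover have "v \<le> c \<nu> \<bullet> x + ((\<Sum>(r, q, s)\<in>\<nu>. \<mu> (r, q, s) * s) + \<theta> \<bullet> qvec D \<omega>)"
      using le [OF \<nu>] by (simp add: d leaf_dual_value_affine c)
    ultimately show "let (\<theta>, \<mu>) = duals \<nu> in
        (\<forall>j. (l - (\<Sum>(r, q, s)\<in>\<nu>. \<mu> (r, q, s) *\<^sub>R r) + transpose (Tmat D \<omega>) *v \<theta>
               - transpose (Amat D) *v 0 - \<gamma> \<nu>) $ j \<le> 0) \<and>
        v - l \<bullet> x - (\<Sum>(r, q, s)\<in>\<nu>. \<mu> (r, q, s) * s) - \<theta> \<bullet> qvec D \<omega> + 0 \<bullet> bvec D + \<gamma> \<nu> \<bullet> 1 \<le> 0 \<and>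
        (\<forall>i. 0 \<le> (0::real^_) $ i) \<and> (\<forall>j. 0 \<le> \<gamma> \<nu> $ j)"
      by (simp add: d c algebra_simps)
  qed
  then show ?thesis
    by (intro exI [of _ l] exI [of _ "v - l \<bullet> x"] exI) auto
qed

text \<open>The leaf \<open>\<nu>\<^sub>0\<close> caps the objective at \<open>v\<close>, and a
  tight cut attains this cap.\<close>

lemma cut_lp_optimal_iff:
  assumes "finite \<L>" and "x \<in> Xset D" and "binary x"
    and le: "\<And>\<nu>. \<nu> \<in> \<L> \<Longrightarrow> v \<le> leaf_dual_value D \<omega> x \<nu> (duals \<nu>)"
    and attained: "\<nu>\<^sub>0 \<in> \<L>" "leaf_dual_value D \<omega> x \<nu>\<^sub>0 (duals \<nu>\<^sub>0) \<le> v"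
  shows "cut_lp_optimal D \<omega> x \<L> duals (l, \<sigma>, \<beta>, \<gamma>) \<longleftrightarrow>
    cut_lp_feasible D \<omega> \<L> duals (l, \<sigma>, \<beta>, \<gamma>) \<and> l \<bullet> x + \<sigma> = v"
proof -
  have ub: "l \<bullet> x + \<sigma> \<le> v" if "cut_lp_feasible D \<omega> \<L> duals (l, \<sigma>, \<beta>, \<gamma>)" for l \<sigma> \<beta> \<gamma>
    using cut_lp_feasible_bound [OF that attained(1) assms(2,3)] attained(2) by linarith
  obtain l' \<sigma>' \<beta>' \<gamma>' where "cut_lp_feasible D \<omega> \<L> duals (l', \<sigma>', \<beta>', \<gamma>')" "l' \<bullet> x + \<sigma>' = v"
    using cut_lp_feasible_tight [OF assms(1,3) le] by blast
  then show ?thesis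
    unfolding cut_lp_optimal_def is_arg_max_def using ub by fastforce
qed


subsection \<open>The sub-problem algorithm\<close>

lemma closed_Gset:
  assumes "\<And>i. i \<in> Iset D \<Longrightarrow> convex_on UNIV (gfun D \<omega> i)"
  shows "closed (Gset D \<omega>)"
proof -
  have "closed {v. gfun D \<omega> i v \<le> 0}" if "i \<in> Iset D" for i
    using convex_on_continuous [OF open_UNIV assms [OF that]]
    by (intro closed_Collect_le) auto
  moreover have "Gset D \<omega> = (\<Inter>i\<in>Iset D. {v. gfun D \<omega> i v \<le> 0})"
    by (auto simp: Gset_def)
  ultimately show ?thesis by auto
qed

lemma convex_Gset:
  fixes D :: "('x::finite, 'y::finite, 'w::finite, 'e::finite, 'm::finite, 'i) problem"
  assumes "\<And>i. i \<in> Iset D \<Longrightarrow> convex_on UNIV (gfun D \<omega> i)"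
  shows "convex (Gset D \<omega>)"
proof -
  have "convex {v. gfun D \<omega> i v \<le> 0}" if "i \<in> Iset D" for i
  proof (rule convexI)
    fix u w :: "(real^'x) \<times> (real^'y)" and a b :: real
    assume uw: "u \<in> {v. gfun D \<omega> i v \<le> 0}" "w \<in> {v. gfun D \<omega> i v \<le> 0}" "0 \<le> a" "0 \<le> b" "a + b = 1"
    then have "gfun D \<omega> i (a *\<^sub>R u + b *\<^sub>R w) \<le> a * gfun D \<omega> i u + b * gfun D \<omega> i w"
      using assms [OF that] by (simp add: convex_on_def del: split_paired_All)
    also have "\<dots> \<le> 0"
      using uw by (intro add_nonpos_nonpos mult_nonneg_nonpos) auto
    finally show "a *\<^sub>R u + b *\<^sub>R w \<in> {v. gfun D \<omega> i v \<le> 0}" by simp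
  qed
  moreover have "Gset D \<omega> = (\<Inter>i\<in>Iset D. {v. gfun D \<omega> i v \<le> 0})"
    by (auto simp: Gset_def)
  ultimately show ?thesis by (auto intro: convex_INT)
qed

lemma Sset_eq: "Sset D \<omega> = Gset D \<omega> \<inter> UNIV \<times> Yset D \<omega>"
  by (auto simp: Sset_def)

text \<open>Convexity makes the cuts valid, the polytopes bound the leaf programs, compactness and
  nonemptiness of \<open>Pset D\<close> give a worst-case distribution, and nonnegative
  probabilities preserve scenario bounds under aggregation.\<close>

locale two_stage =
  fixes D :: "('x::finite, 'y::finite, 'w::finite, 'e::finite, 'm::finite, 'i) problem"
  assumes convex_gfun: "\<And>\<omega> i. i \<in> Iset D \<Longrightarrow> convex_on UNIV (gfun D \<omega> i)"
    and finite_Yineq: "\<And>\<omega>. finite (Yineq D \<omega>)"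
    and polytope_Yset: "\<And>\<omega>. polytope (Yset D \<omega>)"
    and compact_Pset: "compact (Pset D)"
    and Pset_nonempty: "Pset D \<noteq> {}"
    and Pset_nonneg: "\<And>p \<omega>. p \<in> Pset D \<Longrightarrow> 0 \<le> p $ \<omega>"
begin

section \<open>Validity of the cuts in the sub-problem algorithm\<close>

text \<open>The cut is the variational inequality that characterises the projection onto a closed
  convex set.\<close>

lemma projection_cut_valid:
  assumes "projection_cut D \<omega> x y k" and "v \<in> Sset D \<omega>"
  shows "lin_fun k v \<le> 0"
proof -
  obtain \<pi> where \<pi>: "is_arg_min (dist (x, y)) (\<lambda>v. v \<in> Sset D \<omega>) \<pi>"
    and k: "k = (x - fst \<pi>, y - snd \<pi>, - (((x, y) - \<pi>) \<bullet> \<pi>))"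
    using assms(1) by (auto simp: projection_cut_def)
  have "closed (Sset D \<omega>)" "convex (Sset D \<omega>)"
    unfolding Sset_eq
    using closed_Gset [of D \<omega>] convex_Gset [of D \<omega>] convex_gfun
      polytope_imp_closed [OF polytope_Yset [of \<omega>]] polytope_imp_convex [OF polytope_Yset [of \<omega>]]
    by (simp_all add: closed_Int convex_Int closed_Times convex_Times)
  then have "((x, y) - \<pi>) \<bullet> (v - \<pi>) \<le> 0"
    using \<pi> assms(2) by (intro any_closest_point_dot [of "Sset D \<omega>"]) (auto simp: is_arg_min_linorder)
  then show ?thesis
    by (cases v; cases \<pi>) (simp add: k lin_fun_def algebra_simps)
qed

lemma normal_cut_valid:
  assumes "normal_cut D \<omega> x z y k" and "v \<in> Sset D \<omega>"
  shows "lin_fun k v \<le> 0"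
proof -
  obtain dx dy where k: "k = (dx, dy, - (dx \<bullet> x + dy \<bullet> y))"
    and n: "(dx, dy) \<in> normal_cone (Gset D \<omega>) (x, y)"
    using assms(1) by (auto simp: normal_cut_def)
  have "(dx, dy) \<bullet> (v - (x, y)) \<le> 0"
    using n assms(2) by (auto simp: normal_cone_def Sset_eq)
  then show ?thesis
    by (cases v) (simp add: k lin_fun_def algebra_simps)
qed

lemma sub_alg_cuts_valid:
  assumes "sub_alg_cuts D \<omega> x cuts"
  shows "finite cuts" and "\<And>k v. k \<in> cuts \<Longrightarrow> v \<in> Sset D \<omega> \<Longrightarrow> lin_fun k v \<le> 0"
  using assms
  by (induction rule: sub_alg_cuts.induct) (auto dest: projection_cut_valid normal_cut_valid)

text \<open>Cuts generated at \<open>x'\<close> hold on all of \<open>Sset D \<omega>\<close>, not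
  merely on the slice at \<open>x'\<close>, so they remain valid at every \<open>x\<close>.\<close>

lemma master_relaxation:
  assumes "sub_alg_cuts D \<omega> x' cuts"
  shows "sub_feasible D \<omega> x \<subseteq> milp_feasible D \<omega> x cuts"
proof
  fix y assume y: "y \<in> sub_feasible D \<omega> x"
  then have S: "(x, y) \<in> Sset D \<omega>"
    by (auto simp: sub_feasible_def sub_relaxed_feasible_def Sset_def Gset_def)
  then have "a \<bullet> y \<le> r" if "(a, r) \<in> Yineq D \<omega>" for a r
    using that by (auto simp: Sset_def Yset_def)
  then have "lin_fun (0, a, - r) (x, y) \<le> 0" if "(a, r) \<in> Yineq D \<omega>" for a r
    using that by (simp add: lin_fun_def)
  then have "lin_fun k (x, y) \<le> 0" if "k \<in> master_cons D \<omega> cuts" for k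
    using that sub_alg_cuts_valid(2) [OF assms _ S] by (fastforce simp: master_cons_def)
  then show "y \<in> milp_feasible D \<omega> x cuts"
    using y by (auto simp: milp_feasible_def lp_feasible_def sub_feasible_def sub_relaxed_feasible_def)
qed

lemma finite_master_cons: "finite cuts \<Longrightarrow> finite (master_cons D \<omega> cuts)"
  by (simp add: master_cons_def finite_Yineq)

section \<open>Outcomes of the sub-problem algorithm\<close>

lemma sub_alg_infeasible:
  assumes "sub_alg D \<omega> x Infeasible"
  shows "recourse D x \<omega> = \<infinity>"
  using assms
proof cases
  case (claim_infeasible cuts)
  then have "sub_feasible D \<omega> x = {}"
    using master_relaxation [OF claim_infeasible(1), of x] by auto
  then show ?thesis
    by (simp add: recourse_def top_ereal_def)
qed

text \<open>Treats both ways of returning a solution alike: \<open>y\<close> may solve only the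
  integer-fixed program, but its value equals the master value, so it inherits the lower bound over
  the master.\<close>

lemma sub_alg_optimal:
  assumes "sub_alg D \<omega> x (Optimal y \<L>)"
  obtains cuts t where "finite cuts"
    and "\<And>x. sub_feasible D \<omega> x \<subseteq> milp_feasible D \<omega> x cuts"
    and "branch_vars t \<subseteq> Jint D" and "\<L> = bb_leaves t (master_cons D \<omega> cuts)"
    and "y \<in> sub_feasible D \<omega> x"
    and "\<And>\<nu> y'. \<nu> \<in> \<L> \<Longrightarrow> y' \<in> lp_feasible D \<omega> x \<nu> \<Longrightarrow> hvec D \<omega> \<bullet> y \<le> hvec D \<omega> \<bullet> y'"
proof -
  have "\<exists>cuts t y'. sub_alg_cuts D \<omega> x cuts \<and> bb_solves D \<omega> x cuts y' t \<and>
      \<L> = bb_leaves t (master_cons D \<omega> cuts) \<and> y \<in> sub_feasible D \<omega> x \<and> hvec D \<omega> \<bullet> y = hvec D \<omega> \<bullet> y'"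
    using assms
  proof cases
    case (return_master cuts t)
    then show ?thesis
      by (intro exI [of _ cuts] exI [of _ t] exI [of _ y])
        (auto simp: bb_solves_def is_arg_min_def milp_feasible_def lp_feasible_def sub_feasible_def
          sub_relaxed_feasible_def Sset_def Gset_def)
  next
    case (return_fixed cuts y' t k)
    then show ?thesis
      by (intro exI [of _ cuts] exI [of _ t] exI [of _ y'])
        (auto simp: bb_solves_def is_arg_min_def milp_feasible_def sub_feasible_def
          fixed_optimal_def fixed_feasible_def integral_part_def)
  qed
  then obtain cuts t y' where cuts: "sub_alg_cuts D \<omega> x cuts" and bb: "bb_solves D \<omega> x cuts y' t"
    and L: "\<L> = bb_leaves t (master_cons D \<omega> cuts)" and y: "y \<in> sub_feasible D \<omega> x"
    and eq: "hvec D \<omega> \<bullet> y = hvec D \<omega> \<bullet> y'" by blast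
  have min: "hvec D \<omega> \<bullet> y \<le> hvec D \<omega> \<bullet> u" if "u \<in> milp_feasible D \<omega> x cuts" for u
    using bb that eq by (auto simp: bb_solves_def is_arg_min_linorder)
  have "hvec D \<omega> \<bullet> y \<le> hvec D \<omega> \<bullet> u" if \<nu>: "\<nu> \<in> \<L>" and u: "u \<in> lp_feasible D \<omega> x \<nu>" for \<nu> u
  proof -
    \<comment> \<open>Fathoming by infeasibility is excluded by \<open>u\<close>. An integral leaf
      optimum is feasible for the master problem, hence not better than \<open>y\<close>; the last
      reason is the bound itself.\<close>
    have "fathomed D \<omega> x (hvec D \<omega> \<bullet> y) \<nu>"
      using bb \<nu> eq by (auto simp: bb_solves_def L)
    then consider u' where "is_arg_min (\<lambda>y. hvec D \<omega> \<bullet> y) (\<lambda>y. y \<in> lp_feasible D \<omega> x \<nu>) u'"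
        "integral_part D u'"
      | "\<forall>u\<in>lp_feasible D \<omega> x \<nu>. hvec D \<omega> \<bullet> y \<le> hvec D \<omega> \<bullet> u"
      using u by (auto simp: fathomed_def)
    then show ?thesis
    proof cases
      case 1
      then have "u' \<in> milp_feasible D \<omega> x cuts"
        using lp_feasible_antimono [OF bb_leaves_superset [OF \<nu> [unfolded L]]]
        by (auto simp: milp_feasible_def is_arg_min_def)
      then show ?thesis
        using 1(1) u min [of u'] by (fastforce simp: is_arg_min_linorder)
    qed (use u in blast)
  qed
  with cuts bb L y show thesis
    by (intro that [of cuts t]) (auto simp: bb_solves_def sub_alg_cuts_valid(1) dest: master_relaxation)
qed

text \<open>Every feasible solution lies in some leaf, and \<open>y\<close> bounds each leaf program
  from below while being feasible itself.\<close>

lemma recourse_eq: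
  assumes "sub_alg D \<omega> x (Optimal y \<L>)"
  shows "recourse D x \<omega> = ereal (hvec D \<omega> \<bullet> y)"
proof -
  obtain cuts t where c: "sub_feasible D \<omega> x \<subseteq> milp_feasible D \<omega> x cuts"
    "branch_vars t \<subseteq> Jint D" "\<L> = bb_leaves t (master_cons D \<omega> cuts)" "y \<in> sub_feasible D \<omega> x"
    "\<And>\<nu> y'. \<nu> \<in> \<L> \<Longrightarrow> y' \<in> lp_feasible D \<omega> x \<nu> \<Longrightarrow> hvec D \<omega> \<bullet> y \<le> hvec D \<omega> \<bullet> y'"
    using sub_alg_optimal [OF assms] by metis
  have "hvec D \<omega> \<bullet> y \<le> hvec D \<omega> \<bullet> y'" if "y' \<in> sub_feasible D \<omega> x" for y'
    using c(1,3,5) that bb_leaves_cover [of y' D \<omega> x "master_cons D \<omega> cuts" t, OF _ _ c(2)]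
    by (auto simp: milp_feasible_def)
  then show ?thesis
    unfolding recourse_def using c(4) by (intro antisym INF_lower INF_greatest) auto
qed

section \<open>Dual vectors at the leaves\<close>

text \<open>Each leaf contains the inequalities of \<open>Yset D \<omega>\<close>. A nonzero
  recession direction would thus generate a ray in this nonempty bounded set, so the Farkas lemma
  applies, even when the leaf is infeasible.\<close>

lemma leaf_dual_reaches:
  assumes "finite K" and "master_cons D \<omega> {} \<subseteq> K" and "Yset D \<omega> \<noteq> {}"
    and le: "\<And>y. y \<in> lp_feasible D \<omega> x K \<Longrightarrow> v \<le> hvec D \<omega> \<bullet> y"
  shows "\<exists>d. leaf_dual_feasible D \<omega> K d \<and> v \<le> leaf_dual_value D \<omega> x K d"
proof -
  have "\<exists>\<theta> \<mu>. (\<forall>k\<in>K. 0 \<le> \<mu> k) \<and>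
      transpose (Wmat D \<omega>) *v \<theta> - (\<Sum>k\<in>K. \<mu> k *\<^sub>R fst (snd k)) = hvec D \<omega> \<and>
      v \<le> \<theta> \<bullet> (qvec D \<omega> - Tmat D \<omega> *v x) + (\<Sum>k\<in>K. \<mu> k * (fst k \<bullet> x + snd (snd k)))"
  proof (rule farkas_bounded_eq [OF assms(1)])
    fix a assume a: "\<And>k. k \<in> K \<Longrightarrow> fst (snd k) \<bullet> a \<le> 0"
    obtain y where y: "y \<in> Yset D \<omega>"
      using assms(3) by auto
    have "y + r *\<^sub>R a \<in> Yset D \<omega>" if "0 \<le> r" for r
      unfolding Yset_def
    proof clarsimp
      fix b \<beta> assume b: "(b, \<beta>) \<in> Yineq D \<omega>"
      then have "(0, b, - \<beta>) \<in> K"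
        using assms(2) by (force simp: master_cons_def)
      then have "b \<bullet> a \<le> 0"
        using a by fastforce
      moreover have "b \<bullet> y \<le> \<beta>"
        using y b by (auto simp: Yset_def)
      ultimately show "b \<bullet> (y + r *\<^sub>R a) \<le> \<beta>"
        using mult_nonneg_nonpos [OF that, of "b \<bullet> a"] by (simp add: inner_add_right)
    qed
    moreover have "bounded (Yset D \<omega>)"
      using polytope_Yset by (rule polytope_imp_bounded)
    then obtain B where B: "\<And>u. u \<in> Yset D \<omega> \<Longrightarrow> norm u \<le> B"
      by (auto simp: bounded_iff)
    ultimately have "norm (r *\<^sub>R a) \<le> B + norm y" if "0 \<le> r" for r
      using that norm_triangle_ineq4 [of "y + r *\<^sub>R a" y] by fastforce
    then have le: "r * norm a \<le> B + norm y" if "0 \<le> r" for r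
      using that by fastforce
    show "a = 0"
    proof (rule ccontr)
      assume "a \<noteq> 0"
      \<comment> \<open>The step length makes the displacement have norm \<bar>B\<bar> + norm y + 1,
        one more than the bound can allow.\<close>
      then show False
        using le [of "(\<bar>B\<bar> + norm y + 1) / norm a"] by simp
    qed
  next
    fix y assume "Wmat D \<omega> *v y = qvec D \<omega> - Tmat D \<omega> *v x"
      "\<And>k. k \<in> K \<Longrightarrow> fst (snd k) \<bullet> y + (fst k \<bullet> x + snd (snd k)) \<le> 0"
    then show "v \<le> hvec D \<omega> \<bullet> y"
      by (intro le) (fastforce simp: lp_feasible_def lin_fun_def algebra_simps)
  qed
  then show ?thesis
    by (simp add: leaf_dual_feasible_def leaf_dual_value_def case_prod_unfold)
qed

lemma leaf_duals_value:
  assumes "finite K" and "master_cons D \<omega> {} \<subseteq> K" and "Yset D \<omega> \<noteq> {}"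
    and le: "\<And>y. y \<in> lp_feasible D \<omega> x K \<Longrightarrow> v \<le> hvec D \<omega> \<bullet> y"
    and "leaf_duals D \<omega> x v K d"
  shows "leaf_dual_feasible D \<omega> K d" and "v \<le> leaf_dual_value D \<omega> x K d"
  using leaf_dual_reaches [OF assms(1-4)] assms(5)
  by (auto simp: leaf_duals_def is_arg_max_linorder split: if_splits intro: order_trans)

text \<open>At an infeasible leaf any \<open>v\<close> can be reached. At a feasible leaf the
  reachability lemma is applied to the infimum \<open>w\<close> of the primal program instead, and
  weak duality shows that a vector reaching \<open>w\<close> is optimal.\<close>

lemma leaf_duals_exist:
  assumes "finite K" and "master_cons D \<omega> {} \<subseteq> K" and "Yset D \<omega> \<noteq> {}"
    and le: "\<And>y. y \<in> lp_feasible D \<omega> x K \<Longrightarrow> v \<le> hvec D \<omega> \<bullet> y"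
  shows "\<exists>d. leaf_duals D \<omega> x v K d"
proof (cases "lp_feasible D \<omega> x K = {}")
  case True
  obtain d where "leaf_dual_feasible D \<omega> K d" "v \<le> leaf_dual_value D \<omega> x K d"
    using leaf_dual_reaches [of K \<omega> x v] assms by metis
  with True show ?thesis
    by (intro exI [of _ d]) (simp add: leaf_duals_def)
next
  case False
  define w where "w = (INF y\<in>lp_feasible D \<omega> x K. hvec D \<omega> \<bullet> y)"
  have "bdd_below ((\<lambda>y. hvec D \<omega> \<bullet> y) ` lp_feasible D \<omega> x K)"
    using le by (intro bdd_belowI2 [of _ v])
  then have "w \<le> hvec D \<omega> \<bullet> y" if "y \<in> lp_feasible D \<omega> x K" for y
    unfolding w_def using that by (intro cINF_lower)
  then obtain d where d: "leaf_dual_feasible D \<omega> K d" "w \<le> leaf_dual_value D \<omega> x K d"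
    using leaf_dual_reaches [of K \<omega> x w] assms(1-3) by metis
  have "leaf_dual_value D \<omega> x K d' \<le> w" if "leaf_dual_feasible D \<omega> K d'" for d'
    unfolding w_def using False leaf_weak_duality [OF that] by (intro cINF_greatest)
  then show ?thesis
    using d False by (intro exI [of _ d]) (force simp: leaf_duals_def is_arg_max_linorder)
qed

section \<open>Scenario cuts\<close>

text \<open>The first two conclusions keep the algorithm from getting stuck after a sub-problem; the
  last two are exactness at \<open>x\<close> and validity at every first-stage point.\<close>

lemma scenario_cut:
  assumes sub: "sub_alg D \<omega> x (Optimal y \<L>)" and x: "x \<in> first_stage D"
  shows "\<exists>duals. \<forall>\<nu>\<in>\<L>. leaf_duals D \<omega> x (hvec D \<omega> \<bullet> y) \<nu> (duals \<nu>)" (is ?duals)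
    and "\<forall>\<nu>\<in>\<L>. leaf_duals D \<omega> x (hvec D \<omega> \<bullet> y) \<nu> (duals \<nu>) \<Longrightarrow> \<exists>p. cut_lp_optimal D \<omega> x \<L> duals p"
    and "\<forall>\<nu>\<in>\<L>. leaf_duals D \<omega> x (hvec D \<omega> \<bullet> y) \<nu> (duals \<nu>) \<Longrightarrow>
      cut_lp_optimal D \<omega> x \<L> duals (l, \<sigma>, \<beta>, \<gamma>) \<Longrightarrow> recourse D x \<omega> = ereal (l \<bullet> x + \<sigma>)"
    and "\<forall>\<nu>\<in>\<L>. leaf_duals D \<omega> x (hvec D \<omega> \<bullet> y) \<nu> (duals \<nu>) \<Longrightarrow>
      cut_lp_optimal D \<omega> x \<L> duals (l, \<sigma>, \<beta>, \<gamma>) \<Longrightarrow> x' \<in> first_stage D \<Longrightarrow>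
      ereal (l \<bullet> x' + \<sigma>) \<le> recourse D x' \<omega>"
proof -
  obtain cuts t where cuts: "finite cuts" "\<And>x. sub_feasible D \<omega> x \<subseteq> milp_feasible D \<omega> x cuts"
    and t: "branch_vars t \<subseteq> Jint D" and L: "\<L> = bb_leaves t (master_cons D \<omega> cuts)"
    and y: "y \<in> sub_feasible D \<omega> x"
    and min: "\<And>\<nu> y'. \<nu> \<in> \<L> \<Longrightarrow> y' \<in> lp_feasible D \<omega> x \<nu> \<Longrightarrow> hvec D \<omega> \<bullet> y \<le> hvec D \<omega> \<bullet> y'"
    using sub_alg_optimal [OF sub] by metis
  have leaf: "finite \<nu>" "master_cons D \<omega> {} \<subseteq> \<nu>" if "\<nu> \<in> \<L>" for \<nu>
  proof -
    show "finite \<nu>"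
      using that finite_bb_leaf finite_master_cons [OF cuts(1)] unfolding L by metis
    have "master_cons D \<omega> {} \<subseteq> master_cons D \<omega> cuts"
      by (auto simp: master_cons_def)
    then show "master_cons D \<omega> {} \<subseteq> \<nu>"
      using bb_leaves_superset [OF that [unfolded L]] by (rule subset_trans)
  qed
  have Y: "Yset D \<omega> \<noteq> {}"
    using y by (auto simp: sub_feasible_def sub_relaxed_feasible_def)
  have fin: "finite \<L>"
    by (simp add: L finite_bb_leaves)
  have cover: "\<exists>\<nu>\<in>\<L>. u \<in> lp_feasible D \<omega> x' \<nu>" if "u \<in> sub_feasible D \<omega> x'" for u x'
    using cuts(2) [of x'] that bb_leaves_cover [of u D \<omega> x' "master_cons D \<omega> cuts" t, OF _ _ t]
    by (auto simp: milp_feasible_def L)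
  have x': "x \<in> Xset D" "binary x"
    using x by (auto simp: first_stage_def)
  have "\<exists>d. leaf_duals D \<omega> x (hvec D \<omega> \<bullet> y) \<nu> d" if "\<nu> \<in> \<L>" for \<nu>
    using leaf_duals_exist [of \<nu> \<omega> x] leaf [OF that] Y min [OF that] by metis
  then show ?duals
    by metis
  assume duals: "\<forall>\<nu>\<in>\<L>. leaf_duals D \<omega> x (hvec D \<omega> \<bullet> y) \<nu> (duals \<nu>)"
  have dual: "leaf_dual_feasible D \<omega> \<nu> (duals \<nu>)" "hvec D \<omega> \<bullet> y \<le> leaf_dual_value D \<omega> x \<nu> (duals \<nu>)"
    if "\<nu> \<in> \<L>" for \<nu>
    using leaf_duals_value [of \<nu> \<omega> x] leaf [OF that] Y min [OF that] duals that by metis+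
  \<comment> \<open>At the leaf containing \<open>y\<close>, weak duality caps the dual value by the
    value of \<open>y\<close>; this is the leaf that limits the cut-generating program.\<close>
  obtain \<nu>\<^sub>0 where \<nu>\<^sub>0: "\<nu>\<^sub>0 \<in> \<L>" "y \<in> lp_feasible D \<omega> x \<nu>\<^sub>0"
    using cover [OF y] by blast
  note opt = cut_lp_optimal_iff [OF fin x' dual(2) \<nu>\<^sub>0(1) leaf_weak_duality [OF dual(1) \<nu>\<^sub>0(2)]]
  show "\<exists>p. cut_lp_optimal D \<omega> x \<L> duals p"
    using cut_lp_feasible_tight [OF fin x'(2) dual(2)] opt \<nu>\<^sub>0(1) by blast
  assume "cut_lp_optimal D \<omega> x \<L> duals (l, \<sigma>, \<beta>, \<gamma>)"
  then have cut: "cut_lp_feasible D \<omega> \<L> duals (l, \<sigma>, \<beta>, \<gamma>)" "l \<bullet> x + \<sigma> = hvec D \<omega> \<bullet> y"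
    using opt \<nu>\<^sub>0(1) by blast+
  show "recourse D x \<omega> = ereal (l \<bullet> x + \<sigma>)"
    using recourse_eq [OF sub] cut(2) by simp
  assume "x' \<in> first_stage D"
  then have X: "x' \<in> Xset D" "binary x'"
    by (auto simp: first_stage_def)
  show "ereal (l \<bullet> x' + \<sigma>) \<le> recourse D x' \<omega>"
    unfolding recourse_def
  proof (rule INF_greatest)
    fix u assume "u \<in> sub_feasible D \<omega> x'"
    then obtain \<nu> where "\<nu> \<in> \<L>" "u \<in> lp_feasible D \<omega> x' \<nu>"
      using cover by blast
    then show "ereal (l \<bullet> x' + \<sigma>) \<le> ereal (hvec D \<omega> \<bullet> u)"
      using cut_lp_feasible_bound [OF cut(1) _ X] leaf_weak_duality [OF dual(1)] by fastforce
  qed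
qed

end

subsection \<open>The first stage\<close>

lemma finite_binary: "finite {x :: real^'x::finite. binary x}"
proof -
  have "{x :: real^'x. binary x} \<subseteq> vec_lambda ` (UNIV \<rightarrow>\<^sub>E {0, 1})"
  proof
    fix x :: "real^'x" assume "x \<in> {x. binary x}"
    then have "vec_nth x \<in> UNIV \<rightarrow>\<^sub>E {0, 1}"
      by (auto simp: binary_def)
    then show "x \<in> vec_lambda ` (UNIV \<rightarrow>\<^sub>E {0, 1})"
      by (metis image_eqI vec_nth_inverse)
  qed
  moreover have "finite ((UNIV :: 'x set) \<rightarrow>\<^sub>E {0, 1 :: real})"
    by (intro finite_PiE) auto
  ultimately show ?thesis
    by (meson finite_imageI finite_subset)
qed

lemma not_feasibility_cut_self: "\<not> feasibility_cut x x"
  by (simp add: feasibility_cut_def)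

text \<open>The left-hand side of the cut is the Hamming distance from \<open>xm\<close>, which is
  at least 1 for any other binary point.\<close>

lemma feasibility_cut_neq:
  assumes "binary xm" and "binary x" and "xm \<noteq> x"
  shows "feasibility_cut xm x"
proof -
  have xm: "xm $ j = 0 \<or> xm $ j = 1" and x: "x $ j = 0 \<or> x $ j = 1" for j
    using assms(1,2) by (simp_all add: binary_def)
  have nonneg: "0 \<le> x $ j" "0 \<le> 1 - x $ j" for j
    using x [of j] by auto
  obtain j where j: "xm $ j \<noteq> x $ j"
    using assms(3) by (auto simp: vec_eq_iff)
  have "1 \<le> (\<Sum>j | xm $ j = 0. x $ j)" if "xm $ j = 0"
    using member_le_sum [of j "{j. xm $ j = 0}" "\<lambda>j. x $ j"] that j x [of j] nonneg by auto
  moreover have "1 \<le> (\<Sum>j | xm $ j = 1. 1 - x $ j)" if "xm $ j = 1"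
    using member_le_sum [of j "{j. xm $ j = 1}" "\<lambda>j. 1 - x $ j"] that j x [of j] nonneg by auto
  moreover have "0 \<le> (\<Sum>j | xm $ j = 0. x $ j)" "0 \<le> (\<Sum>j | xm $ j = 1. 1 - x $ j)"
    using nonneg by (auto intro: sum_nonneg)
  ultimately show ?thesis
    using xm [of j] by (auto simp: feasibility_cut_def)
qed

lemma dr_feasible_recourse:
  assumes "dr_feasible D x"
  shows "recourse D x \<omega> \<noteq> \<infinity>"
  using assms by (auto simp: dr_feasible_def dr_objective_def worst_case_recourse_def split: if_splits)

lemma expected_recourse_real:
  assumes "\<And>\<omega>. recourse D x \<omega> = ereal (r \<omega>)"
  shows "expected_recourse D x p = ereal (\<Sum>\<omega>\<in>UNIV. p $ \<omega> * r \<omega>)"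
  by (simp add: expected_recourse_def assms)

lemma worst_case_recourse_eq:
  assumes "\<And>\<omega>. recourse D x \<omega> = ereal (r \<omega>)"
    and "is_arg_max (expected_recourse D x) (\<lambda>p. p \<in> Pset D) p"
  shows "worst_case_recourse D x = expected_recourse D x p"
proof -
  have "(SUP p\<in>Pset D. expected_recourse D x p) = expected_recourse D x p"
    using assms(2) by (intro antisym SUP_least SUP_upper) (auto simp: is_arg_max_linorder)
  then show ?thesis
    by (simp add: worst_case_recourse_def assms(1))
qed

subsection \<open>The decomposition algorithm\<close>

text \<open>At these points an existing cut already forces the master objective up to the upper
  bound, so a master solution among them leaves no gap.\<close>

definition tight_points ::
  "('x::finite,'y::finite,'w::finite,'e::finite,'m::finite,'i) problem \<Rightarrow> 'x master_state \<Rightarrow> (real^'x) set" where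
  "tight_points D st =
     {x \<in> first_stage D. \<exists>(l, \<sigma>)\<in>benders st. upper st \<le> ereal (cvec D \<bullet> x + (l \<bullet> x + \<sigma>))}"

definition open_points ::
  "('x::finite,'y::finite,'w::finite,'e::finite,'m::finite,'i) problem \<Rightarrow> 'x master_state \<Rightarrow> nat" where
  "open_points D st = card (first_stage D - tight_points D st) + card (first_stage D - excluded st)"

text \<open>
  When the master problem returns a point that is already tight, the gap closes at the end of the
  iteration; otherwise the iteration makes its point tight or excluded.  The summand for an open gap
  accounts for the one iteration of the former kind.
\<close>

fun rank :: "('x::finite,'y::finite,'w::finite,'e::finite,'m::finite,'i) problem \<Rightarrow>
    ('x, 'w) decomp_state \<Rightarrow> nat \<times> nat" where
  "rank D (Loop st) = (open_points D st + (if upper st - lower st > 0 then 1 else 0), 0)"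
| "rank D (Scenarios st x dn) = (open_points D st, 2 * card {\<omega>. dn \<omega> = None} + 2)"
| "rank D (Subproblem st x dn \<omega>) = (open_points D st, 2 * card {\<omega>. dn \<omega> = None} + 1)"
| "rank D (Returned x) = (0, 0)"
| "rank D Claimed_Infeasible = (0, 0)"

lemma finite_first_stage: "finite (first_stage D)"
  by (rule finite_subset [OF _ finite_binary]) (auto simp: first_stage_def)

lemma open_points_exclude:
  assumes "x \<in> first_stage D" and "x \<notin> excluded st"
  shows "open_points D (st\<lparr>excluded := insert x (excluded st)\<rparr>) < open_points D st"
proof -
  have "card (first_stage D - insert x (excluded st)) < card (first_stage D - excluded st)"
    using assms finite_first_stage by (intro psubset_card_mono) auto
  then show ?thesis
    by (simp add: open_points_def tight_points_def)
qed

text \<open>Tightness persists because cuts are only added and the upper bound only falls.\<close>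

lemma open_points_benders:
  assumes "benders st \<subseteq> benders st'" and "upper st' \<le> upper st" and "excluded st' = excluded st"
  shows "open_points D st' \<le> open_points D st"
    and "x \<in> tight_points D st' \<Longrightarrow> x \<notin> tight_points D st \<Longrightarrow> open_points D st' < open_points D st"
proof -
  have sub: "tight_points D st \<subseteq> tight_points D st'"
    using assms(1) order_trans [OF assms(2)] unfolding tight_points_def by blast
  then have "card (first_stage D - tight_points D st') \<le> card (first_stage D - tight_points D st)"
    using finite_first_stage by (intro card_mono) auto
  then show "open_points D st' \<le> open_points D st"
    by (simp add: open_points_def assms(3))
  assume "x \<in> tight_points D st'" "x \<notin> tight_points D st"
  then have "card (first_stage D - tight_points D st') < card (first_stage D - tight_points D st)"
  proof (intro psubset_card_mono)
    have "x \<in> first_stage D"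
      using \<open>x \<in> tight_points D st'\<close> by (simp add: tight_points_def)
    then show "first_stage D - tight_points D st' \<subset> first_stage D - tight_points D st"
      using sub \<open>x \<in> tight_points D st'\<close> \<open>x \<notin> tight_points D st\<close> by blast
  qed (simp add: finite_first_stage)
  then show "open_points D st' < open_points D st"
    by (simp add: open_points_def assms(3))
qed

text \<open>Finiteness is needed as \<open>- \<infinity> - (- \<infinity>) = \<infinity>\<close> in extended-real arithmetic.\<close>

lemma gap_closed: "\<bar>a\<bar> \<noteq> \<infinity> \<Longrightarrow> a - b > 0 \<longleftrightarrow> b < a" for a b :: ereal
  by (cases a; cases b) auto

context two_stage
begin

section \<open>Worst-case distributions and aggregated cuts\<close>

lemma worst_case_attained:
  assumes "\<And>\<omega>. recourse D x \<omega> = ereal (r \<omega>)"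
  shows "\<exists>p. is_arg_max (expected_recourse D x) (\<lambda>p. p \<in> Pset D) p"
proof -
  have "continuous_on (Pset D) (\<lambda>p. \<Sum>\<omega>\<in>UNIV. p $ \<omega> * r \<omega>)"
    by (intro continuous_intros)
  then obtain p where "p \<in> Pset D"
    "\<forall>p'\<in>Pset D. (\<Sum>\<omega>\<in>UNIV. p' $ \<omega> * r \<omega>) \<le> (\<Sum>\<omega>\<in>UNIV. p $ \<omega> * r \<omega>)"
    using continuous_attains_sup [OF compact_Pset Pset_nonempty] by blast
  then show ?thesis
    by (auto simp: is_arg_max_linorder expected_recourse_real [of D x r, OF assms])
qed

text \<open>The distribution \<open>p\<close>, although chosen at another point, is a candidate in
  the supremum at \<open>x\<close>.\<close>

lemma aggregated_cut_valid:
  assumes "p \<in> Pset D" and "dr_feasible D x"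
    and "\<And>\<omega>. ereal (lam \<omega> \<bullet> x + sig \<omega>) \<le> recourse D x \<omega>"
  shows "ereal ((\<Sum>\<omega>\<in>UNIV. p $ \<omega> *\<^sub>R lam \<omega>) \<bullet> x + (\<Sum>\<omega>\<in>UNIV. p $ \<omega> * sig \<omega>)) \<le>
    worst_case_recourse D x"
proof -
  have "ereal ((\<Sum>\<omega>\<in>UNIV. p $ \<omega> *\<^sub>R lam \<omega>) \<bullet> x + (\<Sum>\<omega>\<in>UNIV. p $ \<omega> * sig \<omega>)) =
      (\<Sum>\<omega>\<in>UNIV. ereal (p $ \<omega>) * ereal (lam \<omega> \<bullet> x + sig \<omega>))"
    by (simp add: inner_sum_left distrib_left sum.distrib)
  also have "\<dots> \<le> expected_recourse D x p"
    unfolding expected_recourse_def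
    using assms Pset_nonneg by (intro sum_mono ereal_mult_left_mono) auto
  also have "\<dots> \<le> (SUP p\<in>Pset D. expected_recourse D x p)"
    using assms(1) by (rule SUP_upper)
  finally show ?thesis
    using dr_feasible_recourse [OF assms(2)] by (simp add: worst_case_recourse_def)
qed

section \<open>Invariants of the execution\<close>

text \<open>A finite \<open>upper st\<close> is recorded as a real number attained by the incumbent,
  since the sign of the extended-real gap is reliable only then.\<close>

definition master_invariant :: "'x master_state \<Rightarrow> bool" where
  "master_invariant st \<longleftrightarrow>
     (\<forall>(l, \<sigma>)\<in>benders st. \<forall>x. dr_feasible D x \<longrightarrow> ereal (l \<bullet> x + \<sigma>) \<le> worst_case_recourse D x) \<and>
     (\<forall>x\<in>excluded st. x \<in> first_stage D \<and> \<not> dr_feasible D x) \<and>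
     (\<forall>x. dr_feasible D x \<longrightarrow> lower st \<le> dr_objective D x) \<and>
     (upper st = \<infinity> \<or>
       (\<exists>x r. incumbent st = Some x \<and> dr_feasible D x \<and> dr_objective D x = ereal r \<and> upper st = ereal r))"

text \<open>The bound of all cuts at \<open>x\<close> by \<open>lower st\<close> records that
  \<open>x\<close> solves the current master problem; it closes the gap when a tight point is
  revisited.\<close>

definition scenario_invariant ::
  "'x master_state \<Rightarrow> real^'x \<Rightarrow> ('w \<Rightarrow> ((real^'x) \<times> real) option) \<Rightarrow> bool" where
  "scenario_invariant st x dn \<longleftrightarrow> master_invariant st \<and> x \<in> first_stage D \<and> x \<notin> excluded st \<and>
     (\<forall>(l, \<sigma>)\<in>benders st. ereal (cvec D \<bullet> x + (l \<bullet> x + \<sigma>)) \<le> lower st) \<and>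
     (\<forall>\<omega> l \<sigma>. dn \<omega> = Some (l, \<sigma>) \<longrightarrow> recourse D x \<omega> = ereal (l \<bullet> x + \<sigma>) \<and>
        (\<forall>x'\<in>first_stage D. ereal (l \<bullet> x' + \<sigma>) \<le> recourse D x' \<omega>))"

fun invariant :: "('x, 'w) decomp_state \<Rightarrow> bool" where
  "invariant (Loop st) = master_invariant st"
| "invariant (Scenarios st x dn) = scenario_invariant st x dn"
| "invariant (Subproblem st x dn \<omega>) = (scenario_invariant st x dn \<and> dn \<omega> = None)"
| "invariant (Returned x) = dr_optimal D x"
| "invariant Claimed_Infeasible = dr_infeasible D"

text \<open>Excluded points are infeasible, hence differ from \<open>x\<close>, so no feasibility
  cut removes it. This makes the master optimum a lower bound.\<close>

lemma master_relaxes: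
  assumes "master_invariant st" and "dr_feasible D x"
  shows "(x, worst_case_recourse D x) \<in> master_feasible D st"
proof -
  have "feasibility_cut xm x" if "xm \<in> excluded st" for xm
    using assms that
    by (intro feasibility_cut_neq) (auto simp: master_invariant_def dr_feasible_def first_stage_def)
  then show ?thesis
    using assms by (auto simp: master_feasible_def master_invariant_def dr_feasible_def)
qed

text \<open>Scenario cuts are exact at \<open>x\<close> and \<open>p\<close> is a worst-case
  distribution there, so the aggregated cut equals the worst-case recourse at
  \<open>x\<close>.\<close>

lemma all_scenarios_done:
  assumes "scenario_invariant st x dn" and "\<And>\<omega>. dn \<omega> = Some (lam \<omega>, sig \<omega>)"
    and p: "is_arg_max (expected_recourse D x) (\<lambda>p. p \<in> Pset D) p"
  defines "l \<equiv> \<Sum>\<omega>\<in>UNIV. p $ \<omega> *\<^sub>R lam \<omega>" and "\<sigma> \<equiv> \<Sum>\<omega>\<in>UNIV. p $ \<omega> * sig \<omega>"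
  shows "expected_recourse D x p = ereal (l \<bullet> x + \<sigma>)"
    and "dr_objective D x = ereal (cvec D \<bullet> x + (l \<bullet> x + \<sigma>))"
    and "dr_feasible D x"
    and "\<And>x'. dr_feasible D x' \<Longrightarrow> ereal (l \<bullet> x' + \<sigma>) \<le> worst_case_recourse D x'"
proof -
  have r: "recourse D x \<omega> = ereal (lam \<omega> \<bullet> x + sig \<omega>)" for \<omega>
    using assms(1,2) by (auto simp: scenario_invariant_def)
  show E: "expected_recourse D x p = ereal (l \<bullet> x + \<sigma>)"
    by (simp add: expected_recourse_real [of D x, OF r] l_def \<sigma>_def inner_sum_left distrib_left sum.distrib)
  then show obj: "dr_objective D x = ereal (cvec D \<bullet> x + (l \<bullet> x + \<sigma>))"
    by (simp add: dr_objective_def worst_case_recourse_eq [of D x, OF r p])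
  then show "dr_feasible D x"
    using assms(1) by (simp add: dr_feasible_def scenario_invariant_def)
  fix x' assume x': "dr_feasible D x'"
  then have "ereal (lam \<omega> \<bullet> x' + sig \<omega>) \<le> recourse D x' \<omega>" for \<omega>
    using assms(1,2) by (auto simp: scenario_invariant_def dr_feasible_def)
  then show "ereal (l \<bullet> x' + \<sigma>) \<le> worst_case_recourse D x'"
    using p x' unfolding l_def \<sigma>_def by (intro aggregated_cut_valid) (auto simp: is_arg_max_def)
qed

lemma invariant_step:
  assumes "decomp_step D a b" and "invariant a"
  shows "invariant b"
  using assms
proof cases
  case (return_best st x)
  then have inv: "master_invariant st"
    using assms(2) by simp
  \<comment> \<open>In extended-real arithmetic \<infinity> minus anything is \<infinity>, so the
    loop cannot end before there is an incumbent.\<close>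
  have "upper st \<noteq> \<infinity>"
    using return_best(3) by auto
  then have up: "dr_feasible D x" "dr_objective D x = upper st" "upper st \<le> lower st"
    using inv return_best(3,4) by (auto simp: master_invariant_def gap_closed)
  have "upper st \<le> dr_objective D y" if "dr_feasible D y" for y
    using inv that up(3) by (auto simp: master_invariant_def intro: order_trans)
  then show ?thesis
    using up by (auto simp: return_best dr_optimal_def is_arg_min_linorder)
next
  case (master_infeasible st)
  then show ?thesis
    using assms(2) master_relaxes [of st] by (auto simp: dr_infeasible_def)
next
  case (master_solved st x \<eta>)
  have inv: "master_invariant st"
    using assms(2) master_solved by simp
  have feas: "(x, \<eta>) \<in> master_feasible D st"
    and min: "(x', \<eta>') \<in> master_feasible D st \<Longrightarrow> ereal (cvec D \<bullet> x) + \<eta> \<le> ereal (cvec D \<bullet> x') + \<eta>'" for x' \<eta>'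
    using master_solved(4) by (fastforce simp: master_optimal_def is_arg_min_linorder)+
  have "ereal (cvec D \<bullet> x) + \<eta> \<le> dr_objective D x'" if "dr_feasible D x'" for x'
    unfolding dr_objective_def using inv that by (intro min master_relaxes)
  moreover have "ereal (cvec D \<bullet> x + (l \<bullet> x + \<sigma>)) \<le> ereal (cvec D \<bullet> x) + \<eta>" if "(l, \<sigma>) \<in> benders st" for l \<sigma>
  proof -
    have "ereal (l \<bullet> x + \<sigma>) \<le> \<eta>"
      using feas that by (auto simp: master_feasible_def)
    then have "ereal (cvec D \<bullet> x) + ereal (l \<bullet> x + \<sigma>) \<le> ereal (cvec D \<bullet> x) + \<eta>"
      by (rule add_left_mono)
    then show ?thesis by simp
  qed
  moreover have "x \<notin> excluded st"
    using feas not_feasibility_cut_self by (auto simp: master_feasible_def)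
  ultimately show ?thesis
    using inv feas by (auto simp: master_solved scenario_invariant_def master_invariant_def master_feasible_def)
next
  case (sub_infeasible \<omega> x st dn)
  then have "\<not> dr_feasible D x"
    using dr_feasible_recourse sub_alg_infeasible by blast
  then show ?thesis
    using assms(2) by (auto simp: sub_infeasible scenario_invariant_def master_invariant_def)
next
  case (sub_optimal \<omega> x y \<L> duals l s \<beta> \<gamma> st dn)
  then have "x \<in> first_stage D"
    using assms(2) by (simp add: scenario_invariant_def)
  then show ?thesis
    using assms(2) scenario_cut(3,4) [OF sub_optimal(3) _ sub_optimal(4,5)]
    by (auto simp: sub_optimal(1,2) scenario_invariant_def)
next
  case (add_benders dn lam sig x p val st)
  then have inv: "scenario_invariant st x dn"
    using assms(2) by simp
  note fin = all_scenarios_done [OF inv add_benders(3)[rule_format] add_benders(4)]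
  show ?thesis
    using inv fin add_benders(5)
    by (auto simp: add_benders(1,2) scenario_invariant_def master_invariant_def min_def)
qed (use assms(2) in auto)

section \<open>Progress and termination\<close>

lemma progress:
  assumes "invariant a"
    and "\<And>st. a = Loop st \<Longrightarrow> upper st - lower st > 0 \<Longrightarrow>
          master_feasible D st = {} \<or> (\<exists>x \<eta>. master_optimal D st (x, \<eta>))"
    and "\<And>st x dn \<omega>. a = Subproblem st x dn \<omega> \<Longrightarrow> \<exists>res. sub_alg D \<omega> x res"
    and "\<And>x. a \<noteq> Returned x" and "a \<noteq> Claimed_Infeasible"
  shows "\<exists>b. decomp_step D a b"
proof (cases a)
  case (Loop st)
  show ?thesis
  proof (cases "upper st - lower st > 0")
    case True
    then show ?thesis
      using assms(2) [OF Loop True] unfolding Loop by (metis decomp_step.master_infeasible decomp_step.master_solved)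
  next
    case False
    then have "upper st \<noteq> \<infinity>" by auto
    then obtain x where "incumbent st = Some x"
      using assms(1) Loop by (auto simp: master_invariant_def)
    then show ?thesis
      using False unfolding Loop by (metis decomp_step.return_best)
  qed
next
  case (Scenarios st x dn)
  then have inv: "scenario_invariant st x dn"
    using assms(1) by simp
  show ?thesis
  proof (cases "\<exists>\<omega>. dn \<omega> = None")
    case True
    then show ?thesis
      unfolding Scenarios by (metis decomp_step.call_sub_alg)
  next
    case False
    define lam sig where "lam = (\<lambda>\<omega>. fst (the (dn \<omega>)))" and "sig = (\<lambda>\<omega>. snd (the (dn \<omega>)))"
    have dn: "dn \<omega> = Some (lam \<omega>, sig \<omega>)" for \<omega>
      using False by (auto simp: lam_def sig_def)
    then have "recourse D x \<omega> = ereal (lam \<omega> \<bullet> x + sig \<omega>)" for \<omega>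
      using inv by (auto simp: scenario_invariant_def)
    then obtain p where p: "is_arg_max (expected_recourse D x) (\<lambda>p. p \<in> Pset D) p"
      using worst_case_attained [of x "\<lambda>\<omega>. lam \<omega> \<bullet> x + sig \<omega>"] by metis
    show ?thesis
      unfolding Scenarios using decomp_step.add_benders [OF allI [OF dn] p refl] by (rule exI)
  qed
next
  case (Subproblem st x dn \<omega>)
  then have x: "x \<in> first_stage D"
    using assms(1) by (simp add: scenario_invariant_def)
  obtain res where res: "sub_alg D \<omega> x res"
    using assms(3) [OF Subproblem] by blast
  show ?thesis
  proof (cases res)
    case Infeasible
    then show ?thesis
      using res unfolding Subproblem by (metis decomp_step.sub_infeasible)
  next
    case (Optimal y \<L>)
    then have opt: "sub_alg D \<omega> x (Optimal y \<L>)"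
      using res by simp
    obtain duals where duals: "\<forall>\<nu>\<in>\<L>. leaf_duals D \<omega> x (hvec D \<omega> \<bullet> y) \<nu> (duals \<nu>)"
      using scenario_cut(1) [OF opt x] by (elim exE)
    obtain l \<sigma> \<beta> \<gamma> where "cut_lp_optimal D \<omega> x \<L> duals (l, \<sigma>, \<beta>, \<gamma>)"
      using scenario_cut(2) [OF opt x duals] by (metis prod_cases4)
    then show ?thesis
      using decomp_step.sub_optimal [OF opt duals] unfolding Subproblem by blast
  qed
qed (use assms(4,5) in auto)

text \<open>With \<open>c\<close> scenarios pending, the second component runs through 2c + 2 before
  a call, 2c + 1 during it and 2c after it, as one scenario fewer remains. Returning to the loop
  must therefore only keep the first component from growing, or lower it when coming from a
  sub-problem found infeasible.\<close>

lemma rank_step: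
  assumes "decomp_step D a b" and "invariant a" and "\<And>x. b \<noteq> Returned x" and "b \<noteq> Claimed_Infeasible"
  shows "(rank D b, rank D a) \<in> less_than <*lex*> less_than"
  using assms(1)
proof cases
  case (master_solved st x \<eta>)
  then show ?thesis
    by (simp add: open_points_def tight_points_def)
next
  case (sub_infeasible \<omega> x st dn)
  then have "open_points D (st\<lparr>excluded := insert x (excluded st)\<rparr>) < open_points D st"
    using assms(2) by (intro open_points_exclude) (auto simp: scenario_invariant_def)
  then show ?thesis
    by (auto simp: sub_infeasible)
next
  case (sub_optimal \<omega> x y \<L> duals l s \<beta> \<gamma> st dn)
  then have "dn \<omega> = None"
    using assms(2) by simp
  then have "{\<omega>'. (dn(\<omega> \<mapsto> (l, s))) \<omega>' = None} = {\<omega>. dn \<omega> = None} - {\<omega>}" "\<omega> \<in> {\<omega>. dn \<omega> = None}"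
    by auto
  then have "card {\<omega>'. (dn(\<omega> \<mapsto> (l, s))) \<omega>' = None} < card {\<omega>. dn \<omega> = None}"
    by (metis card_Diff1_less finite)
  then show ?thesis
    by (simp add: sub_optimal(1,2))
next
  case (add_benders dn lam sig x p val st)
  then have inv: "scenario_invariant st x dn"
    using assms(2) by simp
  define l \<sigma> where "l = (\<Sum>\<omega>\<in>UNIV. p $ \<omega> *\<^sub>R lam \<omega>)" and "\<sigma> = (\<Sum>\<omega>\<in>UNIV. p $ \<omega> * sig \<omega>)"
  define st' where "st' = st\<lparr>benders := insert (l, \<sigma>) (benders st),
    incumbent := (if val < upper st then Some x else incumbent st), upper := min (upper st) val\<rparr>"
  have b: "b = Loop st'"
    by (simp add: add_benders(2) st'_def l_def \<sigma>_def)
  have val: "val = ereal (cvec D \<bullet> x + (l \<bullet> x + \<sigma>))"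
    using all_scenarios_done(1) [OF inv add_benders(3)[rule_format] add_benders(4)] add_benders(5)
    by (simp add: l_def \<sigma>_def)
  have st': "benders st \<subseteq> benders st'" "upper st' \<le> upper st" "excluded st' = excluded st"
    "lower st' = lower st" "upper st' \<le> val"
    by (auto simp: st'_def)
  have "x \<in> first_stage D"
    using inv by (simp add: scenario_invariant_def)
  then have tight: "x \<in> tight_points D st'"
    using st'(5) by (auto simp: tight_points_def val st'_def)
  \<comment> \<open>If \<open>x\<close> was tight before, the gap closes and its summand vanishes;
    otherwise \<open>x\<close> becomes tight and the drop in open points pays for that
    summand.\<close>
  have "fst (rank D b) \<le> open_points D st"
  proof (cases "x \<in> tight_points D st")
    case True
    then have "upper st \<le> lower st"
      using inv by (fastforce simp: tight_points_def scenario_invariant_def)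
    moreover have "\<bar>upper st'\<bar> \<noteq> \<infinity>"
      using inv by (auto simp: st'_def val scenario_invariant_def master_invariant_def min_def)
    ultimately have "\<not> upper st' - lower st' > 0"
      using st' by (subst gap_closed) auto
    then show ?thesis
      using open_points_benders(1) [OF st'(1-3)] by (simp add: b)
  next
    case False
    then show ?thesis
      using open_points_benders(2) [OF st'(1-3) tight] by (simp add: b)
  qed
  then show ?thesis
    by (auto simp: b add_benders(1))
qed (use assms(3,4) in auto)

end

text \<open>A run that never reaches a final state makes a genuine step each time, by progress, and
  its ranks would descend forever in a well-founded order.\<close>

lemma (in two_stage) terminates:
  assumes exec: "decomp_execution D s" and "masters_solved D s" and "subproblems_solved D s"
  shows "\<exists>n. (\<exists>x. s n = Returned x \<and> dr_optimal D x) \<or> (s n = Claimed_Infeasible \<and> dr_infeasible D)"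
proof -
  have inv: "invariant (s n)" for n
  proof (induction n)
    case 0
    then show ?case
      using exec by (simp add: decomp_execution_def initial_state_def master_invariant_def)
  next
    case (Suc n)
    then show ?case
      using exec invariant_step by (metis decomp_execution_def)
  qed
  have "\<exists>n. (\<exists>x. s n = Returned x) \<or> s n = Claimed_Infeasible"
  proof (rule ccontr)
    assume running: "\<nexists>n. (\<exists>x. s n = Returned x) \<or> s n = Claimed_Infeasible"
    have "(rank D (s (Suc n)), rank D (s n)) \<in> less_than <*lex*> less_than" for n
    proof (rule rank_step)
      have "\<exists>b. decomp_step D (s n) b"
        using running assms(2,3) by (intro progress inv) (auto simp: masters_solved_def subproblems_solved_def)
      then show "decomp_step D (s n) (s (Suc n))"
        using exec by (auto simp: decomp_execution_def)
    qed (use inv running in auto)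
    then have "\<exists>f. \<forall>n. (f (Suc n), f n) \<in> less_than <*lex*> less_than"
      by (intro exI [of _ "\<lambda>n. rank D (s n)"] allI)
    moreover have "wf (less_than <*lex*> less_than)"
      by auto
    ultimately show False
      by (simp add: wf_iff_no_infinite_down_chain)
  qed
  then show ?thesis
    using inv by (metis invariant.simps(4,5))
qed

theorem theorem5p1:
  fixes D :: "('x::finite, 'y::finite, 'w::finite, 'e::finite, 'm::finite, 'i) problem"
    and F :: function_collection
    and solve :: "((real^'x) \<times> (real^'y) \<Rightarrow> real) set \<Rightarrow> ((real^'x) \<times> (real^'y) \<Rightarrow> real) \<Rightarrow>
        ((real^'x) \<times> (real^'y)) option"
    and subgrad :: "((real^'x) \<times> (real^'y) \<Rightarrow> real) \<Rightarrow> (real^'x) \<times> (real^'y) \<Rightarrow> (real^'x) \<times> (real^'y)"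
    and ncone :: "((real^'x) \<times> (real^'y) \<Rightarrow> real) set \<Rightarrow> (real^'x) \<times> (real^'y) \<Rightarrow>
        ((real^'x) \<times> (real^'y)) set"
    and worst :: "real^'w \<Rightarrow> real^'w"
    and s :: "nat \<Rightarrow> ('x, 'w) decomp_state"
  assumes "closed (Cset D)" and "convex (Cset D)"
    and "polytope (Xset D)"
    and "compact (Pset D)"
    and "\<forall>p\<in>Pset D. (\<forall>\<omega>. 0 \<le> p $ \<omega>) \<and> (\<Sum>\<omega>\<in>UNIV. p $ \<omega>) = 1"
    and "linear_oracle (Pset D) worst"
    and "finite (Iset D)"
    and "\<forall>\<omega>. \<forall>i\<in>Iset D. convex_on UNIV (gfun D \<omega> i)"
    and "\<forall>\<omega>. finite (Yineq D \<omega>) \<and> polytope (Yset D \<omega>)"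
    and "subdifferentials_split D"
    and "fixed_sets_regular D"
    and "admissible_collection (CARD('x) + CARD('y)) F"
    and "constraint_funs_in_collection F D s"
    and "convex_program_oracle F solve"
    and "subgradient_oracle F subgrad"
    and "normal_cone_oracle F ncone"
    and "decomp_execution D s"
    and "masters_solved D s"
    and "subproblems_solved D s"
  shows "\<exists>n. (\<exists>x. s n = Returned x \<and> dr_optimal D x) \<or>
             (s n = Claimed_Infeasible \<and> dr_infeasible D)"
proof -
  \<comment> \<open>Nonemptiness of \<open>Pset D\<close> comes from the linear oracle, whose
    answers are members of it.\<close>
  interpret two_stage D
    using assms by unfold_locales (auto simp: linear_oracle_def)
  show ?thesis
    using assms(17-19) by (rule terminates)
qed

end
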